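(* Let $K_1\ge K_2\ge 0$ be integers, with $K_1\ge 1$ when $K_2=0$. Let $\mathrm{a}_1,\ldots,\mathrm{a}_{K_1}$ be pairwise distinct nonzero real numbers and $\mathrm{b}_1,\ldots,\mathrm{b}_{K_2}$ be pairwise distinct nonzero real numbers, and put \[ G(x,y)=\prod_{j=1}^{K_1}(x-\mathrm{a}_j)\prod_{\ell=1}^{K_2}(y-\mathrm{b}_\ell), \] where the empty product $\prod_{\ell=1}^{0}(y-\mathrm{b}_\ell)$ is $1$. Let $P(x,y),Q(x,y)$ be real polynomials of degree $n$, and consider the perturbed system \[ \dot x=-yG(x,y)+\varepsilon P(x,y),\qquad \dot y=xG(x,y)+\varepsilon Q(x,y), \] with small parameter $\varepsilon$. Let $\rho=\min_{j,\ell}\{|\mathrm{a}_j|,|\mathrm{b}_\ell|\}$ and, for $0<r<\rho$, let \[ I(r)=\int_{\gamma_r}\frac{Q(x,y)\,dx-P(x,y)\,dy}{G(x,y)},\qquad \gamma_r=\{(x,y): x^2+y^2=r^2\}, \] be the associated Abelian integral, and assume $I$ is not identically zero on $(0,\rho)$. Define \[ \widetilde K_1=\operatorname{card}\{|\mathrm{a}_1|,\ldots,|\mathrm{a}_{K_1}|\},\quad \widetilde K_2=\operatorname{card}\{|\mathrm{a}_1|,\ldots,|\mathrm{a}_{K_1}|,|\mathrm{b}_1|,\ldots,|\mathrm{b}_{K_2}|\}-\widetilde K_1, \] \[ L=\operatorname{card}\{\mathrm{a}_j^2+\mathrm{b}_\ell^2 : j=1,\ldots,K_1,\ \ell=1,\ldots,K_2\}.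 \] Then the number $\mathcal Z(I)$ of zeros of $I$ in $(0,\rho)$, counted with multiplicity, satisfies \[ \mathcal Z(I)\le \begin{cases} \widetilde K_1\left[\dfrac{n+3}{2}\right]+\left[\dfrac{n}{2}\right], & K_2=0,\\[2mm] (\widetilde K_1+\widetilde K_2)\left(\left[\dfrac{n+2}{2}\right]+L\right)+\left[\dfrac{n-1}{2}\right]+L, & K_2\ge 1. \end{cases} \] (Here $\widetilde K_1\le K_1$, $\widetilde K_2\le K_2$, $L\le K_1K_2$.)
   Context: $[s]$ denotes the integer part of a real number $s$; $\operatorname{card}$ denotes the number of distinct elements of a set. The circle $\gamma_r$ is traversed once (e.g. counterclockwise, parametrized by $(r\cos\theta,r\sin\theta)$, $\theta\in[0,2\pi]$). For $0<r<\rho$, $G$ does not vanish on $\gamma_r$, so $I(r)$ is well defined and analytic in $r$. *)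

theory Defs
  imports "HOL-Analysis.Analysis"
begin

definition poly2 :: "(nat \<Rightarrow> nat \<Rightarrow> real) \<Rightarrow> nat \<Rightarrow> real \<Rightarrow> real \<Rightarrow> real" where
  "poly2 c n x y = (\<Sum>(i, j) \<in> {(i, j). i + j \<le> n}. c i j * x ^ i * y ^ j)"

definition Gfun :: "nat \<Rightarrow> nat \<Rightarrow> (nat \<Rightarrow> real) \<Rightarrow> (nat \<Rightarrow> real) \<Rightarrow> real \<Rightarrow> real \<Rightarrow> real" where
  "Gfun K1 K2 a b x y = (\<Prod>j = 1..K1. x - a j) * (\<Prod>l = 1..K2. y - b l)"

text \<open>Line integral of (Q dx - P dy)/G over the circle of radius r, traversed once
  counterclockwise via (r cos t, r sin t), t in [0, 2 pi].\<close>
definition abelian_int ::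
  "(real \<Rightarrow> real \<Rightarrow> real) \<Rightarrow> (real \<Rightarrow> real \<Rightarrow> real) \<Rightarrow> (real \<Rightarrow> real \<Rightarrow> real) \<Rightarrow> real \<Rightarrow> real" where
  "abelian_int P Q G r = integral {0..2*pi}
     (\<lambda>t. (Q (r * cos t) (r * sin t) * (- r * sin t) - P (r * cos t) (r * sin t) * (r * cos t))
          / G (r * cos t) (r * sin t))"

definition zero_mult :: "(real \<Rightarrow> real) \<Rightarrow> real \<Rightarrow> nat" where
  "zero_mult f x = (LEAST k. (deriv ^^ k) f x \<noteq> 0)"

end

theory Submission
  imports Defs
begin

text \<open>
  Partial fractions reduce \<open>I\<close> to circle integrals of \<open>x\<^sup>i y\<^sup>j / (x - a)\<close> and
  \<open>x\<^sup>i y\<^sup>j / ((x - a) (y - b))\<close>. Recursion on the exponents gives, with \<open>s = r\<^sup>2\<close> and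
  \<open>\<Lambda>(s)\<close> the product of \<open>l - s\<close> over the \<open>L\<close> distinct values \<open>l = a\<^sub>j\<^sup>2 + b\<^sub>l\<^sup>2\<close>, the closed form
  \<open>\<Lambda>(s) I = A(s) + \<Sum>\<^sub>c p\<^sub>c(s) / sqrt (c - s)\<close>, where \<open>c\<close> runs over the distinct squares of the
  \<open>a\<^sub>j\<close> and \<open>b\<^sub>l\<close>, and \<open>deg A < N\<close>, \<open>deg p\<^sub>c < M\<close>.

  Such a function, unless it vanishes, has fewer than \<open>N + M |C|\<close> zeros, by Rolle's theorem. Rewrite
  the sum as \<open>\<Sum>\<^sub>c (c - s)\<^sup>-\<^sup>\<beta> P\<^sub>c(1 / (c - s))\<close> with \<open>deg P\<^sub>c < M\<close> and \<open>\<beta>\<close> not an integer.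
  Multiplication by \<open>(c\<^sub>0 - s)\<^sup>\<beta>\<close> turns the term \<open>c = c\<^sub>0\<close> into a polynomial in \<open>1 / (c\<^sub>0 - s)\<close>, so
  differentiation lowers the degree of that term; up to a positive factor the result is a sum of the
  same shape, with \<open>\<beta> + 1\<close> for \<open>\<beta>\<close> and the other degrees unchanged. Each such step costs one zero,
  and so does each plain derivative, which lowers the degree of \<open>A\<close> as if \<open>A\<close> were the term with
  \<open>c\<^sub>0 = \<infinity>\<close>.
\<close>

subsection \<open>Zeros counted with multiplicity\<close>

definition higher_differentiable_on ::
    "'a set \<Rightarrow> ('a \<Rightarrow> 'a::real_normed_field) \<Rightarrow> nat \<Rightarrow> bool" where
  "higher_differentiable_on U f m \<longleftrightarrow> (\<forall>k<m. \<forall>x\<in>U. (deriv ^^ k) f field_differentiable at x)"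

definition vanishes_to_order :: "nat \<Rightarrow> ('a \<Rightarrow> 'a::real_normed_field) \<Rightarrow> 'a \<Rightarrow> bool" where
  "vanishes_to_order m f x \<longleftrightarrow> (\<forall>k<m. (deriv ^^ k) f x = 0)"

definition zeros_le :: "'a set \<Rightarrow> ('a \<Rightarrow> 'a::real_normed_field) \<Rightarrow> nat \<Rightarrow> bool" where
  "zeros_le U f N \<longleftrightarrow>
     (\<forall>S m. finite S \<longrightarrow> S \<subseteq> U \<longrightarrow> (\<forall>x\<in>S. vanishes_to_order (m x) f x) \<longrightarrow> (\<Sum>x\<in>S. m x) \<le> N)"

lemma higher_deriv_cong_open:
  assumes "open U" "x \<in> U" "\<And>y. y \<in> U \<Longrightarrow> f y = g y"
  shows "(deriv ^^ k) f x = (deriv ^^ k) g x"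
  using assms by (intro higher_deriv_cong_ev refl) (auto simp: eventually_nhds)

lemma higher_differentiable_on_cong:
  assumes "open U" "\<And>x. x \<in> U \<Longrightarrow> f x = g x" "higher_differentiable_on U f m"
  shows "higher_differentiable_on U g m"
  unfolding higher_differentiable_on_def
proof (intro allI impI ballI)
  fix k x assume "k < m" "x \<in> U"
  then obtain D where D: "((deriv ^^ k) f has_field_derivative D) (at x)"
    using assms(3) by (auto simp: higher_differentiable_on_def field_differentiable_def)
  have "((deriv ^^ k) g has_field_derivative D) (at x)"
    by (rule has_field_derivative_transform_within_open[OF D assms(1) \<open>x \<in> U\<close>])
      (intro higher_deriv_cong_open[OF assms(1)] assms(2))
  then show "(deriv ^^ k) g field_differentiable at x"
    by (auto simp: field_differentiable_def)
qed

lemma higher_differentiable_on_0 [simp]: "higher_differentiable_on U f 0"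
  by (simp add: higher_differentiable_on_def)

lemma higher_differentiable_on_Suc:
  "higher_differentiable_on U f (Suc m) \<longleftrightarrow>
     (\<forall>x\<in>U. (f has_field_derivative deriv f x) (at x)) \<and> higher_differentiable_on U (deriv f) m"
  by (auto simp: higher_differentiable_on_def less_Suc_eq_0_disj funpow_Suc_right
      DERIV_deriv_iff_field_differentiable simp del: funpow.simps(2))

lemma higher_differentiable_on_SucI:
  assumes "open U" "\<And>x. x \<in> U \<Longrightarrow> (f has_field_derivative f' x) (at x)"
    and "higher_differentiable_on U f' m"
  shows "higher_differentiable_on U f (Suc m)"
proof -
  have "deriv f x = f' x" if "x \<in> U" for x
    using DERIV_imp_deriv[OF assms(2)] that .
  then show ?thesis
    using assms higher_differentiable_on_cong[of U f' "deriv f" m]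
    by (auto simp: higher_differentiable_on_Suc)
qed

lemma higher_differentiable_on_SucD:
  "higher_differentiable_on U f (Suc m) \<Longrightarrow> higher_differentiable_on U f m"
  by (auto simp: higher_differentiable_on_def)

lemma higher_differentiable_on_const [simp]:
  "open U \<Longrightarrow> higher_differentiable_on U (\<lambda>x. c) m"
proof (induction m arbitrary: c)
  case (Suc m)
  show ?case
    by (rule higher_differentiable_on_SucI[where f' = "\<lambda>_. 0"]) (auto intro: Suc)
qed simp

lemma higher_differentiable_on_ident [simp]:
  "open U \<Longrightarrow> higher_differentiable_on U (\<lambda>x. x) m"
  by (cases m) (auto intro!: higher_differentiable_on_SucI[where f' = "\<lambda>_. 1"] DERIV_ident)

lemma higher_differentiable_on_add:
  assumes "open U"
  shows "higher_differentiable_on U f m \<Longrightarrow> higher_differentiable_on U g m \<Longrightarrow>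
    higher_differentiable_on U (\<lambda>x. f x + g x) m"
proof (induction m arbitrary: f g)
  case (Suc m)
  then show ?case
    by (intro higher_differentiable_on_SucI[where f' = "\<lambda>x. deriv f x + deriv g x"] assms)
      (auto simp: higher_differentiable_on_Suc intro!: DERIV_add)
qed simp

lemma higher_differentiable_on_mult:
  assumes "open U"
  shows "higher_differentiable_on U f m \<Longrightarrow> higher_differentiable_on U g m \<Longrightarrow>
    higher_differentiable_on U (\<lambda>x. f x * g x) m"
proof (induction m arbitrary: f g)
  case (Suc m)
  then have "higher_differentiable_on U f m" "higher_differentiable_on U g m"
    by (auto dest: higher_differentiable_on_SucD)
  with Suc show ?case
    by (intro higher_differentiable_on_SucI[where f' = "\<lambda>x. deriv f x * g x + deriv g x * f x"] assms)
      (auto simp: higher_differentiable_on_Suc intro!: DERIV_mult higher_differentiable_on_add assms)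
qed simp

lemma higher_differentiable_on_sum:
  assumes "open U" "\<And>i. i \<in> A \<Longrightarrow> higher_differentiable_on U (f i) m"
  shows "higher_differentiable_on U (\<lambda>x. \<Sum>i\<in>A. f i x) m"
  using assms(2)
  by (induction A rule: infinite_finite_induct) (auto simp: assms(1) intro: higher_differentiable_on_add)

lemma higher_differentiable_on_poly:
  assumes "open U" "higher_differentiable_on U f m"
  shows "higher_differentiable_on U (\<lambda>x. poly p (f x)) m"
  by (induction p)
    (use assms in \<open>auto intro!: higher_differentiable_on_add higher_differentiable_on_mult\<close>)

lemma higher_differentiable_on_inverse:
  assumes "open U" "\<And>x. x \<in> U \<Longrightarrow> f x \<noteq> 0"
  shows "higher_differentiable_on U f m \<Longrightarrow> higher_differentiable_on U (\<lambda>x. inverse (f x)) m"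
proof (induction m)
  case (Suc m)
  have "higher_differentiable_on U (\<lambda>x. inverse (f x)) m"
    by (rule Suc.IH[OF higher_differentiable_on_SucD[OF Suc.prems]])
  then have "higher_differentiable_on U (\<lambda>x. (- 1) * (inverse (f x) * deriv f x * inverse (f x))) m"
    using Suc.prems assms(1)
    by (intro higher_differentiable_on_mult higher_differentiable_on_const)
      (simp_all add: higher_differentiable_on_Suc)
  then show ?case
    using Suc.prems assms
    by (intro higher_differentiable_on_SucI[where
          f' = "\<lambda>x. - (inverse (f x) * deriv f x * inverse (f x))"])
      (simp_all add: higher_differentiable_on_Suc DERIV_inverse')
qed simp

lemma higher_differentiable_on_powr:
  fixes f :: "real \<Rightarrow> real"
  assumes "open U" "\<And>x. x \<in> U \<Longrightarrow> f x > 0"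
  shows "higher_differentiable_on U f m \<Longrightarrow> higher_differentiable_on U (\<lambda>x. f x powr \<alpha>) m"
proof (induction m arbitrary: \<alpha>)
  case (Suc m)
  have "higher_differentiable_on U (\<lambda>x. f x powr \<alpha>) m" for \<alpha>
    by (rule Suc.IH[OF higher_differentiable_on_SucD[OF Suc.prems]])
  with Suc.prems assms show ?case
    by (intro higher_differentiable_on_SucI[where f' = "\<lambda>x. (\<alpha> * f x powr (\<alpha> - 1)) * deriv f x"])
      (auto simp: higher_differentiable_on_Suc
        intro!: DERIV_chain2[OF has_real_derivative_powr] higher_differentiable_on_mult)
qed simp

lemma higher_differentiable_on_compose:
  assumes U: "open U" and g: "g ` U \<subseteq> V"
  shows "higher_differentiable_on V f m \<Longrightarrow> higher_differentiable_on U g m \<Longrightarrow>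
    higher_differentiable_on U (\<lambda>x. f (g x)) m"
proof (induction m arbitrary: f)
  case (Suc m)
  have "((\<lambda>x. f (g x)) has_field_derivative deriv f (g y) * deriv g y) (at y)" if "y \<in> U" for y
    using Suc.prems g that by (intro DERIV_chain2) (auto simp: higher_differentiable_on_Suc)
  moreover have "higher_differentiable_on U g m"
    using Suc.prems(2) by (rule higher_differentiable_on_SucD)
  ultimately show ?case
    using Suc
    by (intro higher_differentiable_on_SucI[OF U, where f' = "\<lambda>x. deriv f (g x) * deriv g x"])
      (auto simp: higher_differentiable_on_Suc intro!: higher_differentiable_on_mult U)
qed simp

lemma vanishes_to_order_cong:
  assumes "open U" "x \<in> U" "\<And>y. y \<in> U \<Longrightarrow> f y = g y"
  shows "vanishes_to_order m f x \<longleftrightarrow> vanishes_to_order m g x"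
  using higher_deriv_cong_open[OF assms] by (simp add: vanishes_to_order_def)

lemma vanishes_to_order_0 [simp]: "vanishes_to_order 0 f x"
  by (simp add: vanishes_to_order_def)

lemma vanishes_to_order_SucD: "vanishes_to_order (Suc m) f x \<Longrightarrow> vanishes_to_order m f x"
  by (simp add: vanishes_to_order_def)

lemma vanishes_to_order_Suc:
  assumes "open U" "x \<in> U" "\<And>y. y \<in> U \<Longrightarrow> (f has_field_derivative f' y) (at y)"
  shows "vanishes_to_order (Suc m) f x \<longleftrightarrow> f x = 0 \<and> vanishes_to_order m f' x"
proof -
  have "vanishes_to_order m f' x \<longleftrightarrow> vanishes_to_order m (deriv f) x"
    by (rule vanishes_to_order_cong[OF assms(1,2)]) (use DERIV_imp_deriv[OF assms(3)] in simp)
  then show ?thesis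
    by (auto simp: vanishes_to_order_def less_Suc_eq_0_disj funpow_Suc_right
        simp del: funpow.simps(2))
qed

lemma vanishes_to_order_add:
  assumes x: "open U" "x \<in> U"
  shows "higher_differentiable_on U f m \<Longrightarrow> higher_differentiable_on U g m \<Longrightarrow>
    vanishes_to_order m f x \<Longrightarrow> vanishes_to_order m g x \<Longrightarrow> vanishes_to_order m (\<lambda>x. f x + g x) x"
proof (induction m arbitrary: f g)
  case (Suc m)
  then have f: "\<And>y. y \<in> U \<Longrightarrow> (f has_field_derivative deriv f y) (at y)"
    and g: "\<And>y. y \<in> U \<Longrightarrow> (g has_field_derivative deriv g y) (at y)"
    by (auto simp: higher_differentiable_on_Suc)
  have "((\<lambda>x. f x + g x) has_field_derivative deriv f y + deriv g y) (at y)" if "y \<in> U" for y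
    by (intro DERIV_add f g that)
  from vanishes_to_order_Suc[OF x this] show ?case
    using Suc
    by (simp add: vanishes_to_order_Suc[OF x f] vanishes_to_order_Suc[OF x g] higher_differentiable_on_Suc)
qed simp

lemma vanishes_to_order_mult:
  assumes x: "open U" "x \<in> U"
  shows "higher_differentiable_on U f m \<Longrightarrow> higher_differentiable_on U g m \<Longrightarrow>
    vanishes_to_order m f x \<Longrightarrow> vanishes_to_order m (\<lambda>x. f x * g x) x"
proof (induction m arbitrary: f g)
  case (Suc m)
  then have f: "\<And>y. y \<in> U \<Longrightarrow> (f has_field_derivative deriv f y) (at y)"
    and g: "\<And>y. y \<in> U \<Longrightarrow> (g has_field_derivative deriv g y) (at y)"
    and f': "higher_differentiable_on U (deriv f) m" and g': "higher_differentiable_on U (deriv g) m"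
    by (auto simp: higher_differentiable_on_Suc)
  have smooth: "higher_differentiable_on U f m" "higher_differentiable_on U g m"
    using Suc.prems by (auto dest: higher_differentiable_on_SucD)
  have zero: "f x = 0" "vanishes_to_order m (deriv f) x" "vanishes_to_order m f x"
    using Suc.prems(3) vanishes_to_order_Suc[OF x f] by (auto dest: vanishes_to_order_SucD)
  have "vanishes_to_order m (\<lambda>x. deriv f x * g x + f x * deriv g x) x"
    using smooth f' g' zero
    by (intro vanishes_to_order_add[OF x] Suc.IH higher_differentiable_on_mult x(1))
  moreover have deriv:
    "((\<lambda>x. f x * g x) has_field_derivative deriv f y * g y + f y * deriv g y) (at y)"
    if "y \<in> U" for y
    using DERIV_mult[OF f[OF that] g[OF that]] by (simp add: mult.commute)
  ultimately show ?case
    using vanishes_to_order_Suc[OF x deriv, of m] zero(1) by simp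
qed simp

lemma vanishes_to_order_mult_iff:
  assumes x: "open U" "x \<in> U"
    and f: "higher_differentiable_on U f m" and g: "higher_differentiable_on U g m"
    and nz: "\<And>y. y \<in> U \<Longrightarrow> g y \<noteq> 0"
  shows "vanishes_to_order m (\<lambda>x. f x * g x) x \<longleftrightarrow> vanishes_to_order m f x"
proof
  assume "vanishes_to_order m (\<lambda>x. f x * g x) x"
  then have "vanishes_to_order m (\<lambda>x. f x * g x * inverse (g x)) x"
    by (rule vanishes_to_order_mult[OF x, rotated 2])
      (intro higher_differentiable_on_mult higher_differentiable_on_inverse x f g nz)+
  moreover have "f y * g y * inverse (g y) = f y" if "y \<in> U" for y
    using nz[OF that] by simp
  ultimately show "vanishes_to_order m f x"
    using vanishes_to_order_cong[OF x, of "\<lambda>x. f x * g x * inverse (g x)" f m] by simp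
qed (rule vanishes_to_order_mult[OF x f g])

lemma vanishes_to_order_compose_iff:
  assumes x: "open U" "x \<in> U" and V: "open V" "g ` U \<subseteq> V"
    and nz: "\<And>y. y \<in> U \<Longrightarrow> deriv g y \<noteq> 0"
  shows "higher_differentiable_on V f m \<Longrightarrow> higher_differentiable_on U g m \<Longrightarrow>
    vanishes_to_order m (\<lambda>x. f (g x)) x \<longleftrightarrow> vanishes_to_order m f (g x)"
proof (induction m arbitrary: f)
  case (Suc m)
  have gx: "g y \<in> V" if "y \<in> U" for y
    using V that by auto
  have f: "\<And>y. y \<in> V \<Longrightarrow> (f has_field_derivative deriv f y) (at y)"
    and f': "higher_differentiable_on V (deriv f) m"
    and g: "\<And>y. y \<in> U \<Longrightarrow> (g has_field_derivative deriv g y) (at y)"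
    and g': "higher_differentiable_on U (deriv g) m"
    using Suc.prems by (auto simp: higher_differentiable_on_Suc)
  have gm: "higher_differentiable_on U g m"
    using Suc.prems(2) by (rule higher_differentiable_on_SucD)
  have "((\<lambda>x. f (g x)) has_field_derivative deriv f (g y) * deriv g y) (at y)" if "y \<in> U" for y
    by (intro DERIV_chain2 f g gx that)
  then have "vanishes_to_order (Suc m) (\<lambda>x. f (g x)) x \<longleftrightarrow>
      f (g x) = 0 \<and> vanishes_to_order m (\<lambda>x. deriv f (g x) * deriv g x) x"
    by (rule vanishes_to_order_Suc[OF x])
  also have "\<dots> \<longleftrightarrow> f (g x) = 0 \<and> vanishes_to_order m (deriv f) (g x)"
    using vanishes_to_order_mult_iff[OF x higher_differentiable_on_compose[OF x(1) V(2) f' gm] g' nz]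
      Suc.IH[OF f' gm] by simp
  also have "\<dots> \<longleftrightarrow> vanishes_to_order (Suc m) f (g x)"
    using vanishes_to_order_Suc[OF V(1) gx[OF x(2)] f] by simp
  finally show ?case .
qed simp

lemma zeros_leI:
  assumes "\<And>S m. finite S \<Longrightarrow> S \<subseteq> U \<Longrightarrow> (\<And>x. x \<in> S \<Longrightarrow> vanishes_to_order (m x) f x) \<Longrightarrow> sum m S \<le> N"
  shows "zeros_le U f N"
  using assms by (simp add: zeros_le_def)

lemma zeros_leD:
  assumes "zeros_le U f N" "finite S" "S \<subseteq> U" "\<And>x. x \<in> S \<Longrightarrow> vanishes_to_order (m x) f x"
  shows "sum m S \<le> N"
  using assms by (simp add: zeros_le_def)

lemma zeros_le_mono: "zeros_le U f N \<Longrightarrow> N \<le> M \<Longrightarrow> zeros_le U f M"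
  unfolding zeros_le_def by (meson order_trans)

lemma zeros_le_cong:
  assumes "open U" "\<And>x. x \<in> U \<Longrightarrow> f x = g x"
  shows "zeros_le U f N \<longleftrightarrow> zeros_le U g N"
  using vanishes_to_order_cong[OF assms(1) _ assms(2)]
  unfolding zeros_le_def by (simp add: subset_iff)

lemma zeros_le_nonvanishing:
  assumes "\<And>x. x \<in> U \<Longrightarrow> f x \<noteq> 0"
  shows "zeros_le U f N"
proof -
  have "vanishes_to_order m f x \<longleftrightarrow> m = 0" if "x \<in> U" for x m
    using assms[OF that] by (cases m) (auto simp: vanishes_to_order_def)
  then show ?thesis
    by (auto simp: zeros_le_def subset_iff)
qed

lemma zeros_le_mult_iff:
  assumes "open U" "\<And>m. higher_differentiable_on U f m" "\<And>m. higher_differentiable_on U g m"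
    and "\<And>x. x \<in> U \<Longrightarrow> g x \<noteq> 0"
  shows "zeros_le U (\<lambda>x. f x * g x) N \<longleftrightarrow> zeros_le U f N"
  using vanishes_to_order_mult_iff[OF assms(1) _ assms(2-4)]
  unfolding zeros_le_def by (simp add: subset_iff)

lemma zeros_le_compose:
  assumes U: "open U" and V: "open V" "g ` U \<subseteq> V" and inj: "inj_on g U"
    and f: "\<And>m. higher_differentiable_on V f m" and g: "\<And>m. higher_differentiable_on U g m"
    and nz: "\<And>x. x \<in> U \<Longrightarrow> deriv g x \<noteq> 0"
    and N: "zeros_le V f N"
  shows "zeros_le U (\<lambda>x. f (g x)) N"
proof (rule zeros_leI)
  fix S and m :: "'a \<Rightarrow> nat"
  assume S: "finite S" "S \<subseteq> U" "\<And>x. x \<in> S \<Longrightarrow> vanishes_to_order (m x) (\<lambda>x. f (g x)) x"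
  have inv: "inv_into U g (g x) = x" if "x \<in> S" for x
    using that S inj by (auto intro: inv_into_f_f)
  have "vanishes_to_order (m x) f (g x)" if "x \<in> S" for x
    using that S vanishes_to_order_compose_iff[OF U _ V nz f g, of x "m x"] by blast
  moreover have "g ` S \<subseteq> V" using S(2) V(2) by blast
  ultimately have "(\<Sum>y\<in>g ` S. m (inv_into U g y)) \<le> N"
    using S(1) by (intro zeros_leD[OF N]) (auto simp: inv)
  also have "(\<Sum>y\<in>g ` S. m (inv_into U g y)) = sum m S"
    using S inj by (subst sum.reindex) (auto simp: inv intro: inj_on_subset)
  finally show "sum m S \<le> N" .
qed

lemma zeros_le_imp_finite_zeros:
  assumes "zeros_le U f N"
  shows "finite {x\<in>U. f x = 0}"
proof (rule finite_if_finite_subsets_card_bdd[THEN conjunct1])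
  show "card S \<le> N" if "S \<subseteq> {x\<in>U. f x = 0}" "finite S" for S
    using that zeros_leD[OF assms, of S "\<lambda>_. 1"] by (auto simp: vanishes_to_order_def)
qed

lemma zeros_le_imp_finite_order:
  assumes "zeros_le U f N" "x \<in> U"
  shows "\<exists>k. (deriv ^^ k) f x \<noteq> 0"
  using zeros_leD[OF assms(1), of "{x}" "\<lambda>_. Suc N"] assms(2)
  by (auto simp: vanishes_to_order_def)

lemma zeros_le_imp_sum_zero_mult_le:
  assumes "zeros_le U f N"
  shows "(\<Sum>x\<in>{x\<in>U. f x = 0}. zero_mult f x) \<le> N"
proof (rule zeros_leD[OF assms zeros_le_imp_finite_zeros[OF assms]])
  show "vanishes_to_order (zero_mult f x) f x" for x
    unfolding vanishes_to_order_def zero_mult_def using not_less_Least by blast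
qed auto

lemma Rolle_is_interval:
  fixes f f' :: "real \<Rightarrow> real"
  assumes U: "is_interval U" and f: "\<And>x. x \<in> U \<Longrightarrow> (f has_real_derivative f' x) (at x)"
    and xy: "x \<in> U" "y \<in> U" "x < y" "f x = f y"
  shows "\<exists>z\<in>U. x < z \<and> z < y \<and> f' z = 0"
proof -
  have sub: "{x..y} \<subseteq> U"
    using U xy(1,2) unfolding is_interval_1 by (meson atLeastAtMost_iff subset_iff)
  have "\<exists>z>x. z < y \<and> (f has_real_derivative 0) (at z)"
  proof (rule Rolle)
    show "continuous_on {x..y} f"
      by (intro continuous_at_imp_continuous_on ballI DERIV_isCont[OF f]) (use sub in blast)
    show "f differentiable at z" if "x < z" "z < y" for z
    proof -
      have "z \<in> U" using sub that by auto
      then show ?thesis using f by (auto simp: real_differentiable_def)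
    qed
  qed (use xy in auto)
  then obtain z where z: "x < z" "z < y" "(f has_real_derivative 0) (at z)" by blast
  then have "z \<in> U" using sub by auto
  moreover from this have "f' z = 0" using f z(3) DERIV_unique by blast
  ultimately show ?thesis using z by blast
qed

lemma Rolle_zeros_between:
  fixes f f' :: "real \<Rightarrow> real"
  assumes U: "is_interval U" and f: "\<And>x. x \<in> U \<Longrightarrow> (f has_real_derivative f' x) (at x)"
    and S: "finite S" "S \<subseteq> U" "\<And>x. x \<in> S \<Longrightarrow> f x = 0"
  shows "\<exists>T\<subseteq>U. finite T \<and> T \<inter> S = {} \<and> card S \<le> Suc (card T) \<and> (\<forall>x\<in>T. f' x = 0)"
proof -
  have "\<forall>x\<in>S - {Max S}. \<exists>z. z \<in> U - S \<and> x < z \<and> (\<forall>y\<in>S. x < y \<longrightarrow> z < y) \<and> f' z = 0"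
  proof
    fix x assume x: "x \<in> S - {Max S}"
    define y where "y = Min {y\<in>S. x < y}"
    have "x < Max S" using x S(1) by (simp add: less_le)
    moreover have "Max S \<in> S" using x S(1) by (intro Max_in) auto
    ultimately have "Max S \<in> {y\<in>S. x < y}" by simp
    then have "y \<in> {y\<in>S. x < y}"
      unfolding y_def using S(1) by (intro Min_in) auto
    then have y: "y \<in> S" "x < y" and min: "\<And>z. z \<in> S \<Longrightarrow> x < z \<Longrightarrow> y \<le> z"
      using S(1) by (auto simp: y_def)
    obtain z where z: "z \<in> U" "x < z" "z < y" "f' z = 0"
      using Rolle_is_interval[OF U f, of x y] x y S by auto
    then have "z \<notin> S" "\<forall>y\<in>S. x < y \<longrightarrow> z < y"
      using min by force+
    with z show "\<exists>z. z \<in> U - S \<and> x < z \<and> (\<forall>y\<in>S. x < y \<longrightarrow> z < y) \<and> f' z = 0"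
      by blast
  qed
  from bchoice[OF this] obtain z where
    z: "\<forall>x\<in>S - {Max S}. z x \<in> U - S \<and> x < z x \<and> (\<forall>y\<in>S. x < y \<longrightarrow> z x < y) \<and> f' (z x) = 0" ..
  have "strict_mono_on (S - {Max S}) z"
  proof (rule strict_mono_onI)
    fix x y assume "x \<in> S - {Max S}" "y \<in> S - {Max S}" "x < y"
    with z have "z x < y" "y < z y" by auto
    then show "z x < z y" by simp
  qed
  then have "card (z ` (S - {Max S})) = card (S - {Max S})"
    by (intro card_image strict_mono_on_imp_inj_on)
  then show ?thesis
    using z S(1) by (intro exI[of _ "z ` (S - {Max S})"]) (auto simp: card_Diff_singleton_if)
qed

lemma zeros_le_Rolle:
  fixes f f' :: "real \<Rightarrow> real"
  assumes U: "is_interval U" "open U" and f: "\<And>x. x \<in> U \<Longrightarrow> (f has_real_derivative f' x) (at x)"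
    and N: "zeros_le U f' N"
  shows "zeros_le U f (Suc N)"
proof (rule zeros_leI)
  fix S and m :: "real \<Rightarrow> nat"
  assume S: "finite S" "S \<subseteq> U" "\<And>x. x \<in> S \<Longrightarrow> vanishes_to_order (m x) f x"
  define Z where "Z = {x\<in>S. m x > 0}"
  have Z: "finite Z" "Z \<subseteq> U" using S by (auto simp: Z_def)
  have "vanishes_to_order (Suc (m x - 1)) f x" if "x \<in> Z" for x
    using that S(3)[of x] by (simp add: Z_def)
  then have zero: "f x = 0" "vanishes_to_order (m x - 1) f' x" if "x \<in> Z" for x
    using that Z(2) vanishes_to_order_Suc[OF U(2) _ f, of x "m x - 1"] by auto
  obtain T where T: "T \<subseteq> U" "finite T" "T \<inter> Z = {}" "card Z \<le> Suc (card T)" "\<forall>x\<in>T. f' x = 0"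
    using Rolle_zeros_between[OF U(1) f Z zero(1)] by blast
  define m' where "m' x = (if x \<in> T then 1 else m x - 1)" for x
  have "sum m' (T \<union> Z) \<le> N"
    using T Z zero by (intro zeros_leD[OF N]) (auto simp: m'_def vanishes_to_order_def)
  moreover have "sum m' (T \<union> Z) = card T + (\<Sum>x\<in>Z. m x - 1)"
    using T Z by (subst sum.union_disjoint) (auto simp: m'_def disjoint_iff intro!: sum.cong)
  moreover have "sum m S = card Z + (\<Sum>x\<in>Z. m x - 1)"
  proof -
    have "sum m S = sum m Z"
      unfolding Z_def using S by (intro sum.mono_neutral_right) auto
    also have "\<dots> = (\<Sum>x\<in>Z. 1 + (m x - 1))"
      by (intro sum.cong) (auto simp: Z_def)
    finally show ?thesis by (simp add: sum.distrib del: Suc_pred plus_1_eq_Suc One_nat_def)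
  qed
  ultimately show "sum m S \<le> Suc N" using T(4) by linarith
qed

subsection \<open>Sums of algebraic functions with real branch points\<close>

lemma length_coeffs_le_iff: "length (coeffs p) \<le> n \<longleftrightarrow> (\<forall>i\<ge>n. coeff p i = 0)"
proof (cases "p = 0")
  case False
  then have "length (coeffs p) \<le> n \<longleftrightarrow> degree p < n"
    by (simp add: length_coeffs Suc_le_eq)
  also have "\<dots> \<longleftrightarrow> (\<forall>i\<ge>n. coeff p i = 0)"
    using False leading_coeff_0_iff[of p] by (auto simp: coeff_eq_0 not_less[symmetric])
  finally show ?thesis .
qed simp

lemma length_coeffs_pderiv:
  fixes p :: "'a::{idom, semiring_char_0} poly"
  shows "length (coeffs (pderiv p)) = length (coeffs p) - 1"
proof (cases "degree p = 0")
  case True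
  then have "pderiv p = 0" by (simp add: pderiv_eq_0_iff)
  with True show ?thesis by (simp add: degree_eq_length_coeffs)
next
  case False
  then have "p \<noteq> 0" "pderiv p \<noteq> 0" by (auto simp: pderiv_eq_0_iff)
  with False show ?thesis by (simp add: length_coeffs degree_pderiv)
qed

definition euler_op :: "'a::idom \<Rightarrow> 'a poly \<Rightarrow> 'a poly" where
  "euler_op \<beta> p = smult \<beta> p + pCons 0 (pderiv p)"

lemma coeff_euler_op: "coeff (euler_op \<beta> p) i = (\<beta> + of_nat i) * coeff p i"
  by (cases i) (simp_all add: euler_op_def coeff_pderiv algebra_simps)

lemma euler_op_0 [simp]: "euler_op \<beta> 0 = 0"
  by (simp add: euler_op_def)

lemma length_coeffs_pderiv_add_smult_euler_op:
  fixes p :: "'a::field_char_0 poly"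
  assumes "\<beta> \<notin> \<int>\<^sub>\<le>\<^sub>0" "k \<noteq> 0"
  shows "length (coeffs (smult l (pderiv p) + smult k (euler_op \<beta> p))) = length (coeffs p)"
proof (cases "p = 0")
  case False
  let ?q = "smult l (pderiv p) + smult k (euler_op \<beta> p)"
  have coeff:
    "coeff ?q i = l * of_nat (Suc i) * coeff p (Suc i) + k * (\<beta> + of_nat i) * coeff p i" for i
    by (simp add: coeff_pderiv coeff_euler_op mult.assoc)
  have "coeff ?q (degree p) \<noteq> 0"
    unfolding coeff using assms False plus_of_nat_eq_0_imp[of \<beta> "degree p"] by (auto simp: coeff_eq_0)
  then have "\<not> length (coeffs ?q) \<le> degree p"
    unfolding length_coeffs_le_iff by blast
  moreover have "length (coeffs ?q) \<le> Suc (degree p)"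
    unfolding length_coeffs_le_iff coeff by (auto simp: coeff_eq_0)
  ultimately show ?thesis using False by (simp add: length_coeffs)
qed simp

definition pole_sum :: "real set \<Rightarrow> real \<Rightarrow> (real \<Rightarrow> real poly) \<Rightarrow> real \<Rightarrow> real" where
  "pole_sum C \<beta> P s = (\<Sum>c\<in>C. (c - s) powr - \<beta> * poly (P c) (1 / (c - s)))"

lemma higher_differentiable_on_diff_powr:
  fixes c :: real
  assumes "\<kappa> \<le> c"
  shows "higher_differentiable_on {..<\<kappa>} (\<lambda>s. (c - s) powr \<alpha>) m"
proof (rule higher_differentiable_on_powr)
  have "higher_differentiable_on {..<\<kappa>} (\<lambda>s. poly [:c, -1:] s) m"
    by (intro higher_differentiable_on_poly) auto
  then show "higher_differentiable_on {..<\<kappa>} (\<lambda>s. c - s) m"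
    by simp
qed (use assms in auto)

lemma higher_differentiable_on_pole_sum:
  assumes "\<And>c. c \<in> C \<Longrightarrow> \<kappa> \<le> c"
  shows "higher_differentiable_on {..<\<kappa>} (pole_sum C \<beta> P) m"
proof -
  have "higher_differentiable_on {..<\<kappa>} (\<lambda>s. \<Sum>c\<in>C. (c - s) powr - \<beta> * poly (P c) ((c - s) powr -1)) m"
    using assms
    by (intro higher_differentiable_on_sum higher_differentiable_on_mult higher_differentiable_on_poly
        higher_differentiable_on_diff_powr) auto
  moreover have "(c - s) powr -1 = 1 / (c - s)" if "c \<in> C" "s < \<kappa>" for c s
    using that assms[of c] by (simp add: powr_minus_divide)
  ultimately show ?thesis
    by (elim higher_differentiable_on_cong[rotated 2]) (auto simp: pole_sum_def intro!: sum.cong)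
qed

lemma pole_sum_has_derivative:
  assumes "\<And>c. c \<in> C \<Longrightarrow> s < c"
  shows "(pole_sum C \<beta> P has_real_derivative pole_sum C (\<beta> + 1) (\<lambda>c. euler_op \<beta> (P c)) s) (at s)"
proof -
  have "((\<lambda>s. (c - s) powr - \<beta> * poly (P c) (1 / (c - s))) has_real_derivative
      (c - s) powr - (\<beta> + 1) * poly (euler_op \<beta> (P c)) (1 / (c - s))) (at s)" if "c \<in> C" for c
  proof -
    have pos: "c - s > 0" using assms[OF that] by simp
    have "((\<lambda>s. poly (P c) (1 / (c - s))) has_real_derivative
        poly (pderiv (P c)) (1 / (c - s)) * (1 / (c - s)\<^sup>2)) (at s)"
      using pos by (intro DERIV_chain2[OF poly_DERIV])
        (auto intro!: derivative_eq_intros simp: power2_eq_square)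
    moreover have "((\<lambda>s. (c - s) powr - \<beta>) has_real_derivative \<beta> * (c - s) powr - (\<beta> + 1)) (at s)"
      using pos by (auto intro!: derivative_eq_intros)
    ultimately have "((\<lambda>s. (c - s) powr - \<beta> * poly (P c) (1 / (c - s))) has_real_derivative
        \<beta> * (c - s) powr - (\<beta> + 1) * poly (P c) (1 / (c - s))
        + poly (pderiv (P c)) (1 / (c - s)) * (1 / (c - s)\<^sup>2) * (c - s) powr - \<beta>) (at s)"
      by (intro DERIV_mult)
    also have "(c - s) powr - \<beta> = (c - s) * (c - s) powr - (\<beta> + 1)"
      using pos by (simp add: powr_mult_base)
    also have "\<beta> * (c - s) powr - (\<beta> + 1) * poly (P c) (1 / (c - s))
        + poly (pderiv (P c)) (1 / (c - s)) * (1 / (c - s)\<^sup>2) * ((c - s) * (c - s) powr - (\<beta> + 1))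
        = (c - s) powr - (\<beta> + 1) * poly (euler_op \<beta> (P c)) (1 / (c - s))"
      using pos by (simp add: euler_op_def power2_eq_square distrib_left mult_ac)
    finally show ?thesis .
  qed
  then show ?thesis
    unfolding pole_sum_def[abs_def] by (intro DERIV_sum)
qed

lemma weighted_pole_sum_has_derivative:
  assumes "s < c0" "\<And>c. c \<in> C \<Longrightarrow> s < c"
  shows "((\<lambda>s. pole_sum C \<beta> P s * (c0 - s) powr \<beta>) has_real_derivative
    pole_sum C (\<beta> + 1) (\<lambda>c. pderiv (P c) + smult (c0 - c) (euler_op \<beta> (P c))) s
      * (c0 - s) powr (\<beta> - 1)) (at s)"
proof -
  let ?E = "\<lambda>c. euler_op \<beta> (P c)"
  have summand: "(c0 - s) * ((c - s) powr - (\<beta> + 1) * poly (?E c) (1 / (c - s)))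
      - \<beta> * ((c - s) powr - \<beta> * poly (P c) (1 / (c - s)))
      = (c - s) powr - (\<beta> + 1) * poly (pderiv (P c) + smult (c0 - c) (?E c)) (1 / (c - s))"
    if "c \<in> C" for c
  proof -
    have pos: "c - s > 0" using assms(2)[OF that] by simp
    have "(c - s) powr - \<beta> = (c - s) * (c - s) powr - (\<beta> + 1)"
      using pos by (simp add: powr_mult_base)
    moreover have "(c - s) * (poly (?E c) (1 / (c - s)) - \<beta> * poly (P c) (1 / (c - s)))
        = poly (pderiv (P c)) (1 / (c - s))"
      using pos by (simp add: euler_op_def)
    ultimately show ?thesis by (simp only: poly_add poly_smult) algebra
  qed
  have "((\<lambda>s. (c0 - s) powr \<beta>) has_real_derivative - \<beta> * (c0 - s) powr (\<beta> - 1)) (at s)"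
    using assms(1) by (auto intro!: derivative_eq_intros)
  from DERIV_mult[OF pole_sum_has_derivative[OF assms(2)] this]
  have "((\<lambda>s. pole_sum C \<beta> P s * (c0 - s) powr \<beta>) has_real_derivative
      pole_sum C (\<beta> + 1) ?E s * (c0 - s) powr \<beta>
      - \<beta> * (c0 - s) powr (\<beta> - 1) * pole_sum C \<beta> P s) (at s)"
    by simp
  also have "(c0 - s) powr \<beta> = (c0 - s) * (c0 - s) powr (\<beta> - 1)"
    using assms(1) by (simp add: powr_mult_base)
  also have "pole_sum C (\<beta> + 1) ?E s * ((c0 - s) * (c0 - s) powr (\<beta> - 1))
      - \<beta> * (c0 - s) powr (\<beta> - 1) * pole_sum C \<beta> P s
      = ((c0 - s) * pole_sum C (\<beta> + 1) ?E s - \<beta> * pole_sum C \<beta> P s) * (c0 - s) powr (\<beta> - 1)"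
    by (simp add: algebra_simps)
  also have "(c0 - s) * pole_sum C (\<beta> + 1) ?E s - \<beta> * pole_sum C \<beta> P s
      = pole_sum C (\<beta> + 1) (\<lambda>c. pderiv (P c) + smult (c0 - c) (?E c)) s"
    unfolding pole_sum_def sum_distrib_left sum_subtractf[symmetric] by (intro sum.cong refl summand)
  finally show ?thesis .
qed

lemma pole_sum_zeros_le_Rolle:
  assumes C: "\<And>c. c \<in> C \<Longrightarrow> \<kappa> \<le> c" "c0 \<in> C"
    and N: "zeros_le {..<\<kappa>}
      (pole_sum C (\<beta> + 1) (\<lambda>c. pderiv (P c) + smult (c0 - c) (euler_op \<beta> (P c)))) N"
      (is "zeros_le _ ?D N")
  shows "zeros_le {..<\<kappa>} (pole_sum C \<beta> P) (Suc N)"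
proof -
  have less: "s < c" if "s \<in> {..<\<kappa>}" "c \<in> C" for s c
    using C(1) that by force
  have smooth: "higher_differentiable_on {..<\<kappa>} (\<lambda>s. (c0 - s) powr \<alpha>) m"
    "higher_differentiable_on {..<\<kappa>} (pole_sum C \<alpha> R) m" for \<alpha> R m
    using C by (auto intro: higher_differentiable_on_diff_powr higher_differentiable_on_pole_sum)
  have nonzero: "(c0 - s) powr \<alpha> \<noteq> 0" if "s \<in> {..<\<kappa>}" for s \<alpha>
    using less[OF that C(2)] by simp
  have "zeros_le {..<\<kappa>} (\<lambda>s. ?D s * (c0 - s) powr (\<beta> - 1)) N"
    using N zeros_le_mult_iff[OF open_lessThan smooth(2,1) nonzero] by blast
  then have "zeros_le {..<\<kappa>} (\<lambda>s. pole_sum C \<beta> P s * (c0 - s) powr \<beta>) (Suc N)"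
    using less C(2)
    by (elim zeros_le_Rolle[rotated 3])
      (auto simp: is_interval_1 intro!: weighted_pole_sum_has_derivative)
  then show ?thesis
    using zeros_le_mult_iff[OF open_lessThan smooth(2,1) nonzero] by blast
qed

lemma pole_sum_constant_zeros_le:
  assumes "finite C" "c0 \<in> C" "\<kappa> \<le> c0"
    and P: "P c0 \<noteq> 0" "degree (P c0) = 0" "\<And>c. c \<in> C - {c0} \<Longrightarrow> P c = 0"
  shows "zeros_le {..<\<kappa>} (pole_sum C \<beta> P) N"
proof (rule zeros_le_nonvanishing)
  fix s assume "s \<in> {..<\<kappa>}"
  moreover obtain k where "P c0 = [:k:]" using P(2) by (rule degree_eq_zeroE)
  ultimately show "pole_sum C \<beta> P s \<noteq> 0"
    using assms by (simp add: pole_sum_def sum.remove[of C c0])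
qed

lemma pole_sum_zeros_le:
  assumes C: "finite C" "\<And>c. c \<in> C \<Longrightarrow> \<kappa> \<le> c"
  shows "c0 \<in> C \<Longrightarrow> P c0 \<noteq> 0 \<Longrightarrow> \<beta> \<notin> \<int>\<^sub>\<le>\<^sub>0 \<Longrightarrow>
    zeros_le {..<\<kappa>} (pole_sum C \<beta> P) ((\<Sum>c\<in>C. length (coeffs (P c))) - 1)"
proof (induction "\<Sum>c\<in>C. length (coeffs (P c))" arbitrary: P \<beta> c0 rule: less_induct)
  case less
  let ?w = "\<lambda>P. \<Sum>c\<in>C. length (coeffs (P c))"
  define Q where "Q c = pderiv (P c) + smult (c0 - c) (euler_op \<beta> (P c))" for c
  have length_Q: "length (coeffs (Q c)) = length (coeffs (P c))" if "c \<noteq> c0" for c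
    using that length_coeffs_pderiv_add_smult_euler_op[OF less.prems(3), of "c0 - c" 1 "P c"]
    by (simp add: Q_def)
  have length_Q_c0: "Suc (length (coeffs (Q c0))) = length (coeffs (P c0))"
    using less.prems(2) by (simp add: Q_def length_coeffs_pderiv Suc_pred)
  have weight: "Suc (?w Q) = ?w P"
  proof -
    have "(\<Sum>c\<in>C - {c0}. length (coeffs (Q c))) = (\<Sum>c\<in>C - {c0}. length (coeffs (P c)))"
      by (intro sum.cong) (auto simp: length_Q)
    then show ?thesis
      using C(1) less.prems(1) length_Q_c0 by (simp add: sum.remove[of C c0])
  qed
  show ?case
  proof (cases "\<exists>c1\<in>C. Q c1 \<noteq> 0")
    case True
    then obtain c1 where c1: "c1 \<in> C" "Q c1 \<noteq> 0" by blast
    have "\<beta> + 1 \<notin> \<int>\<^sub>\<le>\<^sub>0" using less.prems(3) plus_one_in_nonpos_Ints_imp by blast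
    with c1 weight have "zeros_le {..<\<kappa>} (pole_sum C (\<beta> + 1) Q) (?w Q - 1)"
      by (intro less.hyps) auto
    then have "zeros_le {..<\<kappa>} (pole_sum C \<beta> P) (Suc (?w Q - 1))"
      unfolding Q_def by (intro pole_sum_zeros_le_Rolle[OF C(2) less.prems(1)])
    moreover have "?w Q \<noteq> 0" using C(1) c1 by auto
    with weight have "Suc (?w Q - 1) = ?w P - 1" by linarith
    ultimately show ?thesis by (simp only:)
  next
    case False
    then have "P c = 0" if "c \<in> C - {c0}" for c
      using that length_Q[of c] by auto
    moreover have "degree (P c0) = 0"
      using False length_Q_c0 less.prems(1) by (simp add: degree_eq_length_coeffs)
    ultimately show ?thesis
      using C less.prems(1,2) by (intro pole_sum_constant_zeros_le)
  qed
qed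

lemma poly_plus_pole_sum_zeros_le_Rolle:
  assumes "\<And>c. c \<in> C \<Longrightarrow> \<kappa> \<le> c"
    and "zeros_le {..<\<kappa>} (\<lambda>s. poly (pderiv A) s + pole_sum C (\<beta> + 1) (\<lambda>c. euler_op \<beta> (P c)) s) N"
  shows "zeros_le {..<\<kappa>} (\<lambda>s. poly A s + pole_sum C \<beta> P s) (Suc N)"
proof (rule zeros_le_Rolle[OF _ _ _ assms(2)])
  show "((\<lambda>s. poly A s + pole_sum C \<beta> P s) has_real_derivative
      poly (pderiv A) s + pole_sum C (\<beta> + 1) (\<lambda>c. euler_op \<beta> (P c)) s) (at s)" if "s \<in> {..<\<kappa>}" for s
    using assms(1) that by (intro DERIV_add poly_DERIV pole_sum_has_derivative) force
qed (auto simp: is_interval_1)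

lemma poly_plus_pole_sum_zeros_le:
  assumes C: "finite C" "\<And>c. c \<in> C \<Longrightarrow> \<kappa> \<le> c"
  shows "A \<noteq> 0 \<or> (\<exists>c\<in>C. P c \<noteq> 0) \<Longrightarrow> \<beta> \<notin> \<int>\<^sub>\<le>\<^sub>0 \<Longrightarrow>
    zeros_le {..<\<kappa>} (\<lambda>s. poly A s + pole_sum C \<beta> P s)
      (length (coeffs A) + (\<Sum>c\<in>C. length (coeffs (P c))) - 1)"
proof (induction "length (coeffs A)" arbitrary: A P \<beta>)
  case 0
  then show ?case using pole_sum_zeros_le[OF C] by auto
next
  case (Suc n)
  define Q where "Q c = euler_op \<beta> (P c)" for c
  have length_Q: "length (coeffs (Q c)) = length (coeffs (P c))" for c
    using length_coeffs_pderiv_add_smult_euler_op[OF Suc.prems(2), of 1 0 "P c"] by (simp add: Q_def)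
  have length_pderiv: "n = length (coeffs (pderiv A))"
    using Suc.hyps(2) by (simp add: length_coeffs_pderiv)
  let ?w = "\<Sum>c\<in>C. length (coeffs (P c))"
  show ?case
  proof (cases "pderiv A \<noteq> 0 \<or> (\<exists>c\<in>C. Q c \<noteq> 0)")
    case True
    have "\<beta> + 1 \<notin> \<int>\<^sub>\<le>\<^sub>0" using Suc.prems(2) plus_one_in_nonpos_Ints_imp by blast
    from Suc.hyps(1)[OF length_pderiv True this]
    have "zeros_le {..<\<kappa>} (\<lambda>s. poly (pderiv A) s + pole_sum C (\<beta> + 1) Q s) (n + ?w - 1)"
      by (simp add: length_Q flip: length_pderiv)
    then have "zeros_le {..<\<kappa>} (\<lambda>s. poly A s + pole_sum C \<beta> P s) (Suc (n + ?w - 1))"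
      unfolding Q_def by (rule poly_plus_pole_sum_zeros_le_Rolle[rotated]) (rule C(2))
    moreover have "n + ?w \<noteq> 0"
      using True length_pderiv C(1) by (auto simp flip: length_Q)
    with Suc.hyps(2) have "Suc (n + ?w - 1) = length (coeffs A) + ?w - 1" by simp
    ultimately show ?thesis by (simp only:)
  next
    case False
    then have "P c = 0" if "c \<in> C" for c
      using that length_Q[of c] by auto
    moreover obtain k where "A = [:k:]" "k \<noteq> 0"
      using False Suc.hyps(2) pderiv_eq_0_iff[of A] degree_eq_zeroE[of A] by force
    ultimately show ?thesis
      by (intro zeros_le_nonvanishing) (simp add: pole_sum_def)
  qed
qed

lemma poly_over_power_as_poly_inverse:
  fixes q :: "'a::field poly"
  assumes "length (coeffs q) \<le> M"
  shows "\<exists>p. length (coeffs p) \<le> M \<and> (\<forall>x. x \<noteq> 0 \<longrightarrow> x * poly q x = x ^ M * poly p (1 / x))"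
proof (cases "q = 0")
  case True
  then show ?thesis by (intro exI[of _ 0]) simp
next
  case False
  with assms have deg: "degree q < M" by (simp add: length_coeffs)
  define p where "p = monom 1 (M - 1 - degree q) * reflect_poly q"
  have "degree p \<le> (M - 1 - degree q) + degree q"
    unfolding p_def by (rule order_trans[OF degree_mult_le add_mono])
      (simp_all add: degree_monom_le degree_reflect_poly_le)
  with deg have "length (coeffs p) \<le> M"
    by (cases "p = 0") (simp_all add: length_coeffs)
  moreover have "x * poly q x = x ^ M * poly p (1 / x)" if "x \<noteq> 0" for x
  proof -
    have "x ^ M = x * x ^ (M - 1 - degree q) * x ^ degree q"
      using deg by (simp flip: power_add power_Suc)
    then show ?thesis
      using that poly_reflect_poly_nz[of "1 / x" q]
      by (simp add: p_def poly_monom inverse_eq_divide power_one_over)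
  qed
  ultimately show ?thesis by blast
qed

lemma poly_mult_powr_as_pole:
  fixes \<alpha> :: real
  assumes "length (coeffs p) \<le> M"
  shows "\<exists>P. length (coeffs P) \<le> M \<and>
    (\<forall>s<c. poly p s * (c - s) powr \<alpha> = (c - s) powr (\<alpha> + real M - 1) * poly P (1 / (c - s)))"
proof -
  have "length (coeffs (pcompose p [:c, -1:])) = length (coeffs p)"
    by (cases "p = 0") (simp_all add: length_coeffs degree_pcompose pcompose_eq_0_iff)
  then obtain P where P: "length (coeffs P) \<le> M"
    "\<And>x. x \<noteq> 0 \<Longrightarrow> x * poly p (c - x) = x ^ M * poly P (1 / x)"
    using poly_over_power_as_poly_inverse[of "pcompose p [:c, -1:]" M] assms
    by (auto simp: poly_pcompose)
  have "poly p s * (c - s) powr \<alpha> = (c - s) powr (\<alpha> + real M - 1) * poly P (1 / (c - s))"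
    if "s < c" for s
  proof -
    have pos: "c - s > 0" using that by simp
    have "(c - s) * poly p s = (c - s) powr real M * poly P (1 / (c - s))"
      using P(2)[of "c - s"] pos by (simp add: powr_realpow)
    moreover have "(c - s) powr (\<alpha> + real M - 1) = (c - s) powr (\<alpha> - 1) * (c - s) powr real M"
      by (simp add: algebra_simps flip: powr_add)
    moreover have "(c - s) powr \<alpha> = (c - s) powr (\<alpha> - 1) * (c - s)"
      using pos by (simp add: powr_mult_base mult.commute)
    ultimately show ?thesis by (simp add: mult_ac)
  qed
  with P(1) show ?thesis by blast
qed

lemma poly_powr_sum_zeros_le:
  fixes \<alpha> :: real
  assumes C: "finite C" "\<And>c. c \<in> C \<Longrightarrow> \<kappa> \<le> c" and \<alpha>: "\<alpha> \<notin> \<int>"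
    and A: "length (coeffs A) \<le> N" and p: "\<And>c. c \<in> C \<Longrightarrow> length (coeffs (p c)) \<le> M"
    and f: "\<And>s. s < \<kappa> \<Longrightarrow> f s = poly A s + (\<Sum>c\<in>C. poly (p c) s * (c - s) powr \<alpha>)"
    and nonzero: "s0 < \<kappa>" "f s0 \<noteq> 0"
  shows "zeros_le {..<\<kappa>} f (card C * M + N - 1)"
proof -
  define \<beta> where "\<beta> = 1 - \<alpha> - real M"
  have "\<forall>c\<in>C. \<exists>P. length (coeffs P) \<le> M \<and>
      (\<forall>s<c. poly (p c) s * (c - s) powr \<alpha> = (c - s) powr - \<beta> * poly P (1 / (c - s)))"
    using poly_mult_powr_as_pole[OF p, of _ _ \<alpha>] by (simp add: \<beta>_def algebra_simps)
  then obtain P where P: "\<And>c. c \<in> C \<Longrightarrow> length (coeffs (P c)) \<le> M"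
    "\<And>c s. c \<in> C \<Longrightarrow> s < c \<Longrightarrow>
      poly (p c) s * (c - s) powr \<alpha> = (c - s) powr - \<beta> * poly (P c) (1 / (c - s))"
    by metis
  have f_eq: "f s = poly A s + pole_sum C \<beta> P s" if "s < \<kappa>" for s
    unfolding f[OF that] pole_sum_def using C(2) that by (force intro!: sum.cong P(2))
  have "A \<noteq> 0 \<or> (\<exists>c\<in>C. P c \<noteq> 0)"
    using nonzero f_eq by (force simp: pole_sum_def)
  moreover have "\<beta> \<notin> \<int>\<^sub>\<le>\<^sub>0"
    using \<alpha> Ints_diff[of "1 - real M" \<beta>] by (auto simp: \<beta>_def dest: nonpos_Ints_Int)
  ultimately have "zeros_le {..<\<kappa>} f (length (coeffs A) + (\<Sum>c\<in>C. length (coeffs (P c))) - 1)"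
    using poly_plus_pole_sum_zeros_le[OF C, of A P \<beta>] f_eq by (subst zeros_le_cong) auto
  moreover have "(\<Sum>c\<in>C. length (coeffs (P c))) \<le> card C * M"
    using sum_bounded_above[of C "\<lambda>c. length (coeffs (P c))" M] P(1) by simp
  ultimately show ?thesis
    using A by (elim zeros_le_mono) linarith
qed

subsection \<open>Integrals over circles\<close>

definition circ_int :: "(real \<Rightarrow> real \<Rightarrow> real) \<Rightarrow> real \<Rightarrow> real" where
  "circ_int u r = integral {0..2*pi} (\<lambda>t. u (r * cos t) (r * sin t))"

definition circ_cont :: "(real \<Rightarrow> real \<Rightarrow> real) \<Rightarrow> real \<Rightarrow> bool" where
  "circ_cont u r \<longleftrightarrow> continuous_on UNIV (\<lambda>t. u (r * cos t) (r * sin t))"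

lemma circ_cont_integrable:
  "circ_cont u r \<Longrightarrow> (\<lambda>t. u (r * cos t) (r * sin t)) integrable_on {c..d}"
  unfolding circ_cont_def by (intro integrable_continuous_interval) (auto intro: continuous_on_subset)

lemma abs_circle_coordinates_le:
  fixes r :: real
  assumes "r \<ge> 0"
  shows "\<bar>r * cos t\<bar> \<le> r" "\<bar>r * sin t\<bar> \<le> r"
  using assms abs_cos_le_one[of t] abs_sin_le_one[of t] by (auto simp: abs_mult intro: mult_left_le)

lemma circ_cont_basic:
  "circ_cont (\<lambda>x y. k) r" "circ_cont (\<lambda>x y. x) r" "circ_cont (\<lambda>x y. y) r"
  by (auto simp: circ_cont_def intro!: continuous_intros)

lemma circ_cont_arith:
  "circ_cont u r \<Longrightarrow> circ_cont v r \<Longrightarrow> circ_cont (\<lambda>x y. u x y + v x y) r"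
  "circ_cont u r \<Longrightarrow> circ_cont v r \<Longrightarrow> circ_cont (\<lambda>x y. u x y * v x y) r"
  "circ_cont u r \<Longrightarrow> circ_cont (\<lambda>x y. u x y ^ n) r"
  by (auto simp: circ_cont_def intro!: continuous_intros)

lemma circ_cont_divide:
  assumes "circ_cont u r" "0 \<le> r" "r < \<bar>a\<bar>"
  shows "circ_cont (\<lambda>x y. u x y / (x - a)) r" "circ_cont (\<lambda>x y. u x y / (y - a)) r"
proof -
  have "r * cos t - a \<noteq> 0" "r * sin t - a \<noteq> 0" for t
    using assms(3) abs_circle_coordinates_le[OF assms(2), of t] by auto
  with assms(1) show "circ_cont (\<lambda>x y. u x y / (x - a)) r" "circ_cont (\<lambda>x y. u x y / (y - a)) r"
    by (auto simp: circ_cont_def intro!: continuous_intros)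
qed

lemmas circ_cont_intros = circ_cont_basic circ_cont_arith circ_cont_divide

lemma circ_cont_swap:
  assumes "circ_cont u r"
  shows "circ_cont (\<lambda>x y. u y x) r"
proof -
  have "continuous_on UNIV ((\<lambda>t. u (r * cos t) (r * sin t)) \<circ> (\<lambda>t. pi / 2 - t))"
    using assms by (intro continuous_on_compose)
      (auto simp: circ_cont_def intro!: continuous_intros intro: continuous_on_subset)
  then show ?thesis by (simp add: circ_cont_def o_def cos_diff sin_diff)
qed

lemma circ_cont_cong:
  assumes "r \<ge> 0" "\<And>x y. \<bar>x\<bar> \<le> r \<Longrightarrow> \<bar>y\<bar> \<le> r \<Longrightarrow> u x y = v x y"
  shows "circ_cont u r \<longleftrightarrow> circ_cont v r"
  unfolding circ_cont_def using assms abs_circle_coordinates_le[of r]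
  by (intro continuous_on_cong) auto

lemma circ_int_cong:
  assumes "r \<ge> 0" "\<And>x y. \<bar>x\<bar> \<le> r \<Longrightarrow> \<bar>y\<bar> \<le> r \<Longrightarrow> x\<^sup>2 + y\<^sup>2 = r\<^sup>2 \<Longrightarrow> u x y = v x y"
  shows "circ_int u r = circ_int v r"
proof -
  have "(r * cos t)\<^sup>2 + (r * sin t)\<^sup>2 = r\<^sup>2" for t
    by (simp add: power_mult_distrib flip: distrib_left)
  then have "u (r * cos t) (r * sin t) = v (r * cos t) (r * sin t)" for t
    using assms abs_circle_coordinates_le[OF assms(1)] by blast
  then show ?thesis by (simp add: circ_int_def)
qed

lemma circ_int_add:
  "circ_cont u r \<Longrightarrow> circ_cont v r \<Longrightarrow> circ_int (\<lambda>x y. u x y + v x y) r = circ_int u r + circ_int v r"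
  unfolding circ_int_def by (intro integral_add circ_cont_integrable)

lemma circ_int_cmult: "circ_int (\<lambda>x y. k * u x y) r = k * circ_int u r"
  unfolding circ_int_def by simp

lemma integral_periodic_shift:
  fixes f :: "real \<Rightarrow> real"
  assumes "continuous_on UNIV f" "\<And>t. f (t + p) = f t" "0 \<le> c" "c \<le> p"
  shows "integral {c..c + p} f = integral {0..p} f"
proof -
  have integrable: "f integrable_on {x..y}" for x y
    using assms(1) by (intro integrable_continuous_interval) (auto intro: continuous_on_subset)
  have "integral {p..c + p} f = integral {0..c} f"
    using integral_shift_real_ivl[of p p "c + p" f] assms(2) by simp
  moreover have "integral {c..p} f + integral {p..c + p} f = integral {c..c + p} f"
    using assms integrable by (intro Henstock_Kurzweil_Integration.integral_combine) auto
  moreover have "integral {0..c} f + integral {c..p} f = integral {0..p} f"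
    using assms integrable by (intro Henstock_Kurzweil_Integration.integral_combine) auto
  ultimately show ?thesis by linarith
qed

lemma circ_int_reflect:
  assumes "circ_cont u r" "0 \<le> c" "c \<le> 2 * pi"
  shows "integral {0..2*pi} (\<lambda>t. u (r * cos (c - t)) (r * sin (c - t))) = circ_int u r"
proof -
  define f where "f t = u (r * cos t) (r * sin t)" for t
  have periodic: "f (t + 2 * pi) = f t" for t by (simp add: f_def)
  have "integral {0..2*pi} (\<lambda>t. f (c - t)) = integral {-(2*pi)..0} (\<lambda>t. f (c + t))"
    using Henstock_Kurzweil_Integration.integral_reflect_real[of 0 "-(2*pi)" "\<lambda>t. f (c + t)"] by simp
  also have "\<dots> = integral {-(2*pi)..0} (\<lambda>t. f (t + (c + 2 * pi)))"
    using periodic by (metis (no_types, opaque_lifting) add.assoc add.commute)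
  also have "\<dots> = integral {c..c + 2 * pi} f"
    using integral_shift_real_ivl[of c "c + 2*pi" "c + 2*pi" f] by simp
  also have "\<dots> = integral {0..2*pi} f"
    using assms periodic by (intro integral_periodic_shift) (auto simp: f_def[abs_def] circ_cont_def)
  finally show ?thesis by (simp add: f_def[abs_def] circ_int_def)
qed

lemma circ_int_swap:
  "circ_cont u r \<Longrightarrow> circ_int (\<lambda>x y. u y x) r = circ_int u r"
  using circ_int_reflect[of u r "pi/2"] by (simp add: circ_int_def cos_diff sin_diff)

lemma circ_int_odd:
  assumes "circ_cont u r"
  shows "(\<And>x y. u (- x) y = - u x y) \<Longrightarrow> circ_int u r = 0"
    and "(\<And>x y. u x (- y) = - u x y) \<Longrightarrow> circ_int u r = 0"
  using circ_int_reflect[OF assms, of pi] circ_int_reflect[OF assms, of "2*pi"]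
  by (simp_all add: circ_int_def cos_diff sin_diff)

lemma DERIV_arctan_divide:
  fixes u v :: "real \<Rightarrow> real"
  assumes "(u has_real_derivative u') (at t)" "(v has_real_derivative v') (at t)" "v t \<noteq> 0"
  shows "((\<lambda>t. arctan (u t / v t)) has_real_derivative
    (u' * v t - u t * v') / ((u t)\<^sup>2 + (v t)\<^sup>2)) (at t)"
proof -
  have "((\<lambda>t. arctan (u t / v t)) has_real_derivative
      inverse (1 + (u t / v t)\<^sup>2) * ((u' * v t - u t * v') / (v t * v t))) (at t)"
    by (intro DERIV_chain2[OF DERIV_arctan] DERIV_divide assms)
  also have "1 + (u t / v t)\<^sup>2 = ((u t)\<^sup>2 + (v t)\<^sup>2) / (v t * v t)"
    using assms(3) by (simp add: power_divide add_divide_distrib power2_eq_square)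
  finally show ?thesis
    using assms(3) by simp
qed

lemma recip_cos_antiderivative:
  fixes k t :: real
  assumes k: "\<bar>k\<bar> < 1"
  defines "w \<equiv> sqrt (1 - k\<^sup>2)"
  shows "((\<lambda>t. (t - 2 * arctan (k * sin t / (1 + w + k * cos t))) / w)
    has_real_derivative 1 / (1 + k * cos t)) (at t)"
proof -
  define e where "e = 1 + k * cos t"
  have "k\<^sup>2 < 1" using k by (simp add: abs_square_less_1)
  then have w: "w > 0" "w\<^sup>2 = 1 - k\<^sup>2" by (auto simp: w_def)
  have "\<bar>k * cos t\<bar> \<le> \<bar>k\<bar>" by (simp add: abs_mult mult_left_le)
  then have e: "e > 0" using k by (simp add: e_def)
  have "((\<lambda>t. arctan (k * sin t / (1 + w + k * cos t))) has_real_derivative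
      (k * cos t * (1 + w + k * cos t) - k * sin t * (k * - sin t))
        / ((k * sin t)\<^sup>2 + (1 + w + k * cos t)\<^sup>2)) (at t)"
    using e w by (intro DERIV_arctan_divide) (auto intro!: derivative_eq_intros simp: e_def)
  also have "k * cos t * (1 + w + k * cos t) - k * sin t * (k * - sin t) = (1 + w) * (e - w)"
    using w(2) sin_cos_squared_add[of t] unfolding e_def by algebra
  also have "(k * sin t)\<^sup>2 + (1 + w + k * cos t)\<^sup>2 = (1 + w) * (2 * e)"
    using w(2) sin_cos_squared_add[of t] unfolding e_def by algebra
  also have "(1 + w) * (e - w) / ((1 + w) * (2 * e)) = (1 - w / e) / 2"
    using w(1) e by (simp add: diff_divide_distrib)
  finally have "((\<lambda>t. (t - 2 * arctan (k * sin t / (1 + w + k * cos t))) / w)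
      has_real_derivative (1 - 2 * ((1 - w / e) / 2)) / w) (at t)"
    by (intro DERIV_cdivide DERIV_diff DERIV_cmult DERIV_ident)
  moreover have "(1 - 2 * ((1 - w / e) / 2)) / w = 1 / e"
    using w(1) by (simp add: diff_divide_distrib)
  ultimately show ?thesis by (simp only: e_def)
qed

lemma integral_recip_cos:
  assumes "\<bar>k\<bar> < (1::real)"
  shows "integral {0..2*pi} (\<lambda>t. 1 / (1 + k * cos t)) = 2 * pi / sqrt (1 - k\<^sup>2)"
proof -
  let ?F = "\<lambda>t. (t - 2 * arctan (k * sin t / (1 + sqrt (1 - k\<^sup>2) + k * cos t))) / sqrt (1 - k\<^sup>2)"
  have "((\<lambda>t. 1 / (1 + k * cos t)) has_integral ?F (2*pi) - ?F 0) {0..2*pi}"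
    using recip_cos_antiderivative[OF assms]
    by (intro fundamental_theorem_of_calculus)
      (auto simp flip: has_real_derivative_iff_has_vector_derivative
        intro: has_field_derivative_at_within)
  then show ?thesis by (simp add: integral_unique)
qed

lemma circ_int_recip:
  assumes "0 \<le> r" "r < \<bar>a\<bar>"
  shows "circ_int (\<lambda>x y. 1 / (x - a)) r = - (2 * pi * sgn a) / sqrt (a\<^sup>2 - r\<^sup>2)"
proof -
  have a: "a \<noteq> 0" using assms by auto
  have "circ_int (\<lambda>x y. 1 / (x - a)) r =
      integral {0..2*pi} (\<lambda>t. (- 1 / a) * (1 / (1 + (- r / a) * cos t)))"
  proof -
    have "1 / (z - a) = (- 1 / a) * (1 / (1 - z / a))" for z
      using a by (cases "z = a") (auto simp: field_simps)
    then show ?thesis unfolding circ_int_def by (intro integral_cong) simp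
  qed
  also have "\<dots> = (- 1 / a) * (2 * pi / sqrt (1 - (- r / a)\<^sup>2))"
    using assms by (subst integral_mult_right, subst integral_recip_cos) (auto simp: abs_divide)
  also have "1 - (- r / a)\<^sup>2 = (a\<^sup>2 - r\<^sup>2) / a\<^sup>2" using a by (simp add: field_simps)
  also have "sqrt ((a\<^sup>2 - r\<^sup>2) / a\<^sup>2) = sqrt (a\<^sup>2 - r\<^sup>2) / \<bar>a\<bar>" by (simp add: real_sqrt_divide)
  finally show ?thesis using a by (simp add: sgn_real_def field_simps abs_if split: if_splits)
qed

lemma circ_int_y_squared_over_linear:
  assumes u: "circ_cont u r" and r: "0 \<le> r" "r < \<bar>a\<bar>"
  shows "circ_int (\<lambda>x y. y\<^sup>2 * u x y / (x - a)) r =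
    (r\<^sup>2 - a\<^sup>2) * circ_int (\<lambda>x y. u x y / (x - a)) r - circ_int (\<lambda>x y. (x + a) * u x y) r"
proof -
  have "circ_int (\<lambda>x y. y\<^sup>2 * u x y / (x - a)) r
      = circ_int (\<lambda>x y. (r\<^sup>2 - a\<^sup>2) * (u x y / (x - a)) + (-1) * ((x + a) * u x y)) r"
  proof (rule circ_int_cong[OF r(1)])
    fix x y :: real assume "\<bar>x\<bar> \<le> r" and xy: "x\<^sup>2 + y\<^sup>2 = r\<^sup>2"
    then have "x - a \<noteq> 0" using r by auto
    moreover have "y\<^sup>2 = (r\<^sup>2 - a\<^sup>2) - (x + a) * (x - a)"
      using xy by (simp add: power2_eq_square algebra_simps)
    ultimately show "y\<^sup>2 * u x y / (x - a) = (r\<^sup>2 - a\<^sup>2) * (u x y / (x - a)) + (-1) * ((x + a) * u x y)"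
      by (simp add: left_diff_distrib diff_divide_distrib)
  qed
  also have "\<dots> = (r\<^sup>2 - a\<^sup>2) * circ_int (\<lambda>x y. u x y / (x - a)) r
      + (-1) * circ_int (\<lambda>x y. (x + a) * u x y) r"
    unfolding circ_int_cmult[symmetric] using u r by (intro circ_int_add circ_cont_intros)
  finally show ?thesis by simp
qed

text \<open>On the circle \<open>(x - a)(x + a) + (y - b)(y + b) = r\<^sup>2 - (a\<^sup>2 + b\<^sup>2)\<close>, which separates
  the two poles.\<close>

lemma circ_int_recip_mixed:
  assumes r: "0 \<le> r" "r < \<bar>a\<bar>" "r < \<bar>b\<bar>"
  shows "(a\<^sup>2 + b\<^sup>2 - r\<^sup>2) * circ_int (\<lambda>x y. 1 / (x - a) / (y - b)) r =
    - a * circ_int (\<lambda>x y. 1 / (x - b)) r - b * circ_int (\<lambda>x y. 1 / (x - a)) r"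
proof -
  have cont: "circ_cont (\<lambda>x y. x / (y - b)) r" "circ_cont (\<lambda>x y. y / (x - a)) r"
    "circ_cont (\<lambda>x y. 1 / (x - b)) r" "circ_cont (\<lambda>x y. 1 / (y - b)) r"
    "circ_cont (\<lambda>x y. 1 / (x - a)) r"
    using r by (auto intro!: circ_cont_intros)
  have odd: "circ_int (\<lambda>x y. x / (y - b)) r = 0" "circ_int (\<lambda>x y. y / (x - a)) r = 0"
    using circ_int_odd(1)[OF cont(1)] circ_int_odd(2)[OF cont(2)] by auto
  have "(a\<^sup>2 + b\<^sup>2 - r\<^sup>2) * circ_int (\<lambda>x y. 1 / (x - a) / (y - b)) r =
     circ_int (\<lambda>x y. (a\<^sup>2 + b\<^sup>2 - r\<^sup>2) * (1 / (x - a) / (y - b))) r"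
    by (simp only: circ_int_cmult)
  also have "\<dots> = circ_int (\<lambda>x y. ((-1) * (x / (y - b)) + (-1) * (y / (x - a))) +
      ((- a) * (1 / (y - b)) + (- b) * (1 / (x - a)))) r"
  proof (rule circ_int_cong[OF r(1)])
    fix x y :: real assume "\<bar>x\<bar> \<le> r" "\<bar>y\<bar> \<le> r" and xy: "x\<^sup>2 + y\<^sup>2 = r\<^sup>2"
    then have "x - a \<noteq> 0" "y - b \<noteq> 0" using r by auto
    then show "(a\<^sup>2 + b\<^sup>2 - r\<^sup>2) * (1 / (x - a) / (y - b)) =
       ((-1) * (x / (y - b)) + (-1) * (y / (x - a))) + ((- a) * (1 / (y - b)) + (- b) * (1 / (x - a)))"
      unfolding xy[symmetric] by (simp add: divide_simps) (simp add: power2_eq_square algebra_simps)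
  qed
  also have "\<dots> = ((-1) * circ_int (\<lambda>x y. x / (y - b)) r + (-1) * circ_int (\<lambda>x y. y / (x - a)) r) +
      ((- a) * circ_int (\<lambda>x y. 1 / (y - b)) r + (- b) * circ_int (\<lambda>x y. 1 / (x - a)) r)"
    by (simp only: circ_int_add circ_int_cmult circ_cont_arith circ_cont_basic cont)
  also have "circ_int (\<lambda>x y. 1 / (y - b)) r = circ_int (\<lambda>x y. 1 / (x - b)) r"
    by (rule circ_int_swap[OF cont(3)])
  finally show ?thesis by (simp add: odd)
qed

subsection \<open>Polynomials combined with reciprocal square roots\<close>

definition sqrt_comb :: "real set \<Rightarrow> real poly \<Rightarrow> (real \<Rightarrow> real poly) \<Rightarrow> real \<Rightarrow> real" where
  "sqrt_comb C A p s = poly A s + (\<Sum>c\<in>C. poly (p c) s / sqrt (c - s))"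

definition sqrt_class :: "real set \<Rightarrow> real \<Rightarrow> nat \<Rightarrow> nat \<Rightarrow> (real \<Rightarrow> real) \<Rightarrow> bool" where
  "sqrt_class C \<rho> N M f \<longleftrightarrow> (\<exists>A p. length (coeffs A) \<le> N \<and> (\<forall>c. length (coeffs (p c)) \<le> M) \<and>
     (\<forall>r\<in>{0<..<\<rho>}. f r = sqrt_comb C A p (r\<^sup>2)))"

lemma sqrt_comb_eq_powr:
  assumes "\<And>c. c \<in> C \<Longrightarrow> s < c"
  shows "sqrt_comb C A p s = poly A s + (\<Sum>c\<in>C. poly (p c) s * (c - s) powr - (1/2))"
proof -
  have "(c - s) powr - (1/2) = 1 / sqrt (c - s)" if "c \<in> C" for c
    using assms[OF that] by (simp add: powr_minus_divide powr_half_sqrt)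
  then show ?thesis by (simp add: sqrt_comb_def)
qed

lemma sqrt_comb_zeros_le:
  assumes C: "finite C" "\<And>c. c \<in> C \<Longrightarrow> \<kappa> \<le> c"
    and "length (coeffs A) \<le> N" "\<And>c. length (coeffs (p c)) \<le> M"
    and "s0 < \<kappa>" "sqrt_comb C A p s0 \<noteq> 0"
  shows "zeros_le {..<\<kappa>} (sqrt_comb C A p) (card C * M + N - 1)"
proof (rule poly_powr_sum_zeros_le[OF C])
  show "- (1 / 2 :: real) \<notin> \<int>"
    using fraction_not_in_Ints[of 2 1, where 'a = real] by simp
  show "sqrt_comb C A p s = poly A s + (\<Sum>c\<in>C. poly (p c) s * (c - s) powr - (1/2))" if "s < \<kappa>" for s
    using C(2) that by (intro sqrt_comb_eq_powr) force
qed (use assms in auto)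

lemma higher_differentiable_on_sqrt_comb:
  assumes "\<And>c. c \<in> C \<Longrightarrow> \<kappa> \<le> c"
  shows "higher_differentiable_on {..<\<kappa>} (sqrt_comb C A p) m"
proof (rule higher_differentiable_on_cong)
  show "higher_differentiable_on {..<\<kappa>}
      (\<lambda>s. poly A s + (\<Sum>c\<in>C. poly (p c) s * (c - s) powr - (1/2))) m"
    using assms
    by (intro higher_differentiable_on_add higher_differentiable_on_sum higher_differentiable_on_mult
        higher_differentiable_on_poly higher_differentiable_on_diff_powr) auto
  show "poly A s + (\<Sum>c\<in>C. poly (p c) s * (c - s) powr - (1/2)) = sqrt_comb C A p s"
    if "s \<in> {..<\<kappa>}" for s
    using assms that by (intro sqrt_comb_eq_powr[symmetric]) force
qed simp

lemma length_coeffs_add_le: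
  "length (coeffs p) \<le> n \<Longrightarrow> length (coeffs q) \<le> n \<Longrightarrow> length (coeffs (p + q)) \<le> n"
  by (simp add: length_coeffs_le_iff)

lemma length_coeffs_mult_le:
  "length (coeffs (p * q)) \<le> length (coeffs p) + length (coeffs q) - 1"
  using degree_mult_le[of p q]
  by (cases "p = 0 \<or> q = 0"; cases "p * q = 0") (auto simp: length_coeffs)

lemma sqrt_classI:
  assumes "length (coeffs A) \<le> N" "\<And>c. length (coeffs (p c)) \<le> M"
    and "\<And>r. 0 < r \<Longrightarrow> r < \<rho> \<Longrightarrow> f r = sqrt_comb C A p (r\<^sup>2)"
  shows "sqrt_class C \<rho> N M f"
  unfolding sqrt_class_def using assms by (intro exI[of _ A] exI[of _ p]) auto

lemma sqrt_classE:
  assumes "sqrt_class C \<rho> N M f"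
  obtains A p where "length (coeffs A) \<le> N" "\<And>c. length (coeffs (p c)) \<le> M"
    "\<And>r. 0 < r \<Longrightarrow> r < \<rho> \<Longrightarrow> f r = sqrt_comb C A p (r\<^sup>2)"
  using assms unfolding sqrt_class_def by (elim exE conjE, intro that) simp_all

lemma sqrt_class_cong:
  assumes "\<And>r. 0 < r \<Longrightarrow> r < \<rho> \<Longrightarrow> f r = g r"
  shows "sqrt_class C \<rho> N M f \<longleftrightarrow> sqrt_class C \<rho> N M g"
  unfolding sqrt_class_def using assms by simp

lemma sqrt_class_mono:
  assumes "sqrt_class C \<rho> N M f" "N \<le> N'" "M \<le> M'"
  shows "sqrt_class C \<rho> N' M' f"
proof -
  from assms(1) obtain A p where "length (coeffs A) \<le> N" "\<And>c. length (coeffs (p c)) \<le> M"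
    "\<And>r. 0 < r \<Longrightarrow> r < \<rho> \<Longrightarrow> f r = sqrt_comb C A p (r\<^sup>2)" by (elim sqrt_classE) blast
  with assms(2,3) show ?thesis by (intro sqrt_classI) (auto intro: order_trans)
qed

lemma sqrt_class_poly:
  assumes "length (coeffs A) \<le> N"
  shows "sqrt_class C \<rho> N M (\<lambda>r. poly A (r\<^sup>2))"
  by (rule sqrt_classI[of A _ "\<lambda>_. 0"]) (use assms in \<open>simp_all add: sqrt_comb_def\<close>)

lemma sqrt_class_recip_sqrt:
  assumes "finite C" "c \<in> C"
  shows "sqrt_class C \<rho> 0 1 (\<lambda>r. k / sqrt (c - r\<^sup>2))"
proof (rule sqrt_classI[of 0 _ "\<lambda>d. if d = c then [:k:] else 0"])
  fix r :: real
  have "k / sqrt (c - r\<^sup>2) = (\<Sum>d\<in>C. if d = c then k / sqrt (d - r\<^sup>2) else 0)"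
    using assms by simp
  also have "\<dots> = sqrt_comb C 0 (\<lambda>d. if d = c then [:k:] else 0) (r\<^sup>2)"
    by (auto simp: sqrt_comb_def intro!: sum.cong)
  finally show "k / sqrt (c - r\<^sup>2) = sqrt_comb C 0 (\<lambda>d. if d = c then [:k:] else 0) (r\<^sup>2)" .
qed (simp_all add: cCons_def)

lemma sqrt_class_add:
  assumes "sqrt_class C \<rho> N M f" "sqrt_class C \<rho> N M g"
  shows "sqrt_class C \<rho> N M (\<lambda>r. f r + g r)"
proof -
  from assms(1) obtain A p where "length (coeffs A) \<le> N" "\<And>c. length (coeffs (p c)) \<le> M"
    "\<And>r. 0 < r \<Longrightarrow> r < \<rho> \<Longrightarrow> f r = sqrt_comb C A p (r\<^sup>2)" by (elim sqrt_classE) blast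
  moreover from assms(2) obtain B q where "length (coeffs B) \<le> N" "\<And>c. length (coeffs (q c)) \<le> M"
    "\<And>r. 0 < r \<Longrightarrow> r < \<rho> \<Longrightarrow> g r = sqrt_comb C B q (r\<^sup>2)" by (elim sqrt_classE) blast
  ultimately show ?thesis
    by (intro sqrt_classI[of "A + B" _ "\<lambda>c. p c + q c"] length_coeffs_add_le)
      (simp_all add: sqrt_comb_def add_divide_distrib sum.distrib)
qed

lemma sqrt_class_poly_mult:
  assumes "length (coeffs B) \<le> Suc d" "sqrt_class C \<rho> N M f"
  shows "sqrt_class C \<rho> (N + d) (M + d) (\<lambda>r. poly B (r\<^sup>2) * f r)"
proof -
  from assms(2) obtain A p where Ap: "length (coeffs A) \<le> N" "\<And>c. length (coeffs (p c)) \<le> M"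
    "\<And>r. 0 < r \<Longrightarrow> r < \<rho> \<Longrightarrow> f r = sqrt_comb C A p (r\<^sup>2)" by (elim sqrt_classE) blast
  have "length (coeffs (B * q)) \<le> n + d" if "length (coeffs q) \<le> n" for q n
    using length_coeffs_mult_le[of B q] assms(1) that by linarith
  with Ap show ?thesis
    by (intro sqrt_classI[of "B * A" _ "\<lambda>c. B * p c"])
      (simp_all add: sqrt_comb_def distrib_left sum_distrib_left)
qed

lemma sqrt_class_cmult:
  assumes "sqrt_class C \<rho> N M f"
  shows "sqrt_class C \<rho> N M (\<lambda>r. k * f r)"
proof -
  have "length (coeffs [:k:]) \<le> Suc 0" by (simp add: cCons_def)
  from sqrt_class_poly_mult[OF this assms] show ?thesis by simp
qed

lemma poly_prod_diff:
  fixes L :: "'a::idom set"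
  shows "poly (\<Prod>l\<in>L. [:l, -1:]) s = (\<Prod>l\<in>L. l - s)"
  by (simp add: poly_prod)

lemma sqrt_class_prod_diff_mult:
  assumes "sqrt_class C \<rho> N M f"
  shows "sqrt_class C \<rho> (N + card L) (M + card L) (\<lambda>r. (\<Prod>l\<in>L. l - r\<^sup>2) * f r)"
proof -
  have "degree (\<Prod>l\<in>L. [:l, -1::real:]) \<le> card L"
    using degree_prod_sum_le[of L "\<lambda>l. [:l, -1::real:]"] by (cases "finite L") auto
  then have "length (coeffs (\<Prod>l\<in>L. [:l, -1::real:])) \<le> Suc (card L)"
    by (cases "(\<Prod>l\<in>L. [:l, -1::real:]) = 0") (simp_all add: length_coeffs)
  from sqrt_class_poly_mult[OF this assms] show ?thesis
    by (simp only: poly_prod_diff)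
qed

lemma zeros_le_compose_square:
  fixes f :: "real \<Rightarrow> real"
  assumes "\<And>m. higher_differentiable_on {..<\<rho>\<^sup>2} f m" "zeros_le {..<\<rho>\<^sup>2} f N"
  shows "zeros_le {0<..<\<rho>} (\<lambda>r. f (r\<^sup>2)) N"
proof (rule zeros_le_compose[OF _ _ _ _ assms(1) _ _ assms(2)])
  show "(\<lambda>r. r\<^sup>2) ` {0<..<\<rho>} \<subseteq> {..<\<rho>\<^sup>2}"
    by (auto intro: power_strict_mono)
  show "inj_on (\<lambda>r. r\<^sup>2) {0<..<\<rho>}"
    by (intro inj_onI) (use power2_eq_iff_nonneg in force)
  show "higher_differentiable_on {0<..<\<rho>} (\<lambda>r. r\<^sup>2) m" for m
    unfolding power2_eq_square by (intro higher_differentiable_on_mult) auto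
  show "deriv (\<lambda>r. r\<^sup>2) r \<noteq> 0" if "r \<in> {0<..<\<rho>}" for r :: real
    using that DERIV_imp_deriv[OF DERIV_pow[of 2 r UNIV]] by simp
qed auto

lemma sqrt_class_zeros_le:
  assumes C: "finite C" "\<And>c. c \<in> C \<Longrightarrow> \<rho>\<^sup>2 \<le> c" and L: "\<And>l. l \<in> L \<Longrightarrow> \<rho>\<^sup>2 \<le> l"
    and f: "sqrt_class C \<rho> N M (\<lambda>r. (\<Prod>l\<in>L. l - r\<^sup>2) * f r)"
    and r0: "0 < r0" "r0 < \<rho>" "f r0 \<noteq> 0"
  shows "zeros_le {0<..<\<rho>} f (card C * M + N - 1)"
proof -
  from f obtain A p where A: "length (coeffs A) \<le> N" and p: "\<And>c. length (coeffs (p c)) \<le> M"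
    and eq: "\<And>r. 0 < r \<Longrightarrow> r < \<rho> \<Longrightarrow> (\<Prod>l\<in>L. l - r\<^sup>2) * f r = sqrt_comb C A p (r\<^sup>2)"
    by (elim sqrt_classE) blast
  define J where "J s = sqrt_comb C A p s * inverse (\<Prod>l\<in>L. l - s)" for s
  have \<Lambda>: "(\<Prod>l\<in>L. l - s) \<noteq> 0" if "s \<in> {..<\<rho>\<^sup>2}" for s
  proof -
    have "(\<Prod>l\<in>L. l - s) > 0" using that L by (intro prod_pos) force
    then show ?thesis by simp
  qed
  have less: "r\<^sup>2 \<in> {..<\<rho>\<^sup>2}" if "r \<in> {0<..<\<rho>}" for r
    using that by (auto intro: power_strict_mono)
  have f_eq: "f r = J (r\<^sup>2)" if "r \<in> {0<..<\<rho>}" for r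
    using eq[of r] \<Lambda>[OF less[OF that]] that by (simp add: J_def field_simps)
  have "higher_differentiable_on {..<\<rho>\<^sup>2} (\<lambda>s. poly (\<Prod>l\<in>L. [:l, -1:]) s) m" for m
    by (intro higher_differentiable_on_poly) auto
  then have inverse_smooth: "higher_differentiable_on {..<\<rho>\<^sup>2} (\<lambda>s. inverse (\<Prod>l\<in>L. l - s)) m" for m
    using \<Lambda> by (intro higher_differentiable_on_inverse) (simp_all add: poly_prod_diff)
  note comb_smooth = higher_differentiable_on_sqrt_comb[OF C(2)]
  have "sqrt_comb C A p (r0\<^sup>2) \<noteq> 0" using r0 f_eq[of r0] by (auto simp: J_def)
  then have "zeros_le {..<\<rho>\<^sup>2} (sqrt_comb C A p) (card C * M + N - 1)"
    using r0 less[of r0] by (intro sqrt_comb_zeros_le[OF C A p, of "r0\<^sup>2"]) auto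
  then have "zeros_le {..<\<rho>\<^sup>2} J (card C * M + N - 1)"
    unfolding J_def[abs_def] using \<Lambda> comb_smooth inverse_smooth by (subst zeros_le_mult_iff) auto
  moreover have "higher_differentiable_on {..<\<rho>\<^sup>2} J m" for m
    unfolding J_def[abs_def] by (intro higher_differentiable_on_mult comb_smooth inverse_smooth) auto
  ultimately have "zeros_le {0<..<\<rho>} (\<lambda>r. J (r\<^sup>2)) (card C * M + N - 1)"
    by (intro zeros_le_compose_square)
  then show ?thesis
    using zeros_le_cong[of "{0<..<\<rho>}" f] f_eq by simp
qed

subsection \<open>Circle integrals of rational functions with poles on lines\<close>

text \<open>The factor \<open>l - r\<^sup>2\<close> clears the poles of the integral at the radii \<open>sqrt l\<close> of the intersection
  points \<open>(a, b)\<close> of the lines, \<open>l = a\<^sup>2 + b\<^sup>2\<close>.\<close>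

definition circ_class ::
    "real set \<Rightarrow> real set \<Rightarrow> real \<Rightarrow> nat \<Rightarrow> nat \<Rightarrow> (real \<Rightarrow> real \<Rightarrow> real) \<Rightarrow> bool" where
  "circ_class C L \<rho> N M u \<longleftrightarrow> (\<forall>r\<in>{0<..<\<rho>}. circ_cont u r) \<and>
     sqrt_class C \<rho> N M (\<lambda>r. (\<Prod>l\<in>L. l - r\<^sup>2) * circ_int u r)"

lemma circ_class_cong:
  assumes "\<And>x y. \<bar>x\<bar> < \<rho> \<Longrightarrow> \<bar>y\<bar> < \<rho> \<Longrightarrow> u x y = v x y"
  shows "circ_class C L \<rho> N M u \<longleftrightarrow> circ_class C L \<rho> N M v"
proof -
  have "circ_cont u r \<longleftrightarrow> circ_cont v r" "circ_int u r = circ_int v r" if "0 < r" "r < \<rho>" for r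
    using that assms by (auto intro!: circ_cont_cong circ_int_cong)
  then show ?thesis
    unfolding circ_class_def by (intro arg_cong2[of _ _ _ _ "(\<and>)"] sqrt_class_cong) auto
qed

lemma circ_class_mono:
  "circ_class C L \<rho> N M u \<Longrightarrow> N \<le> N' \<Longrightarrow> M \<le> M' \<Longrightarrow> circ_class C L \<rho> N' M' u"
  unfolding circ_class_def using sqrt_class_mono by blast

lemma circ_class_add:
  assumes "circ_class C L \<rho> N M u" "circ_class C L \<rho> N M v"
  shows "circ_class C L \<rho> N M (\<lambda>x y. u x y + v x y)"
proof -
  let ?\<Lambda> = "\<lambda>r. \<Prod>l\<in>L. l - r\<^sup>2"
  have "sqrt_class C \<rho> N M (\<lambda>r. ?\<Lambda> r * circ_int u r + ?\<Lambda> r * circ_int v r)"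
    using assms by (intro sqrt_class_add) (auto simp: circ_class_def)
  also have "?this \<longleftrightarrow> sqrt_class C \<rho> N M (\<lambda>r. ?\<Lambda> r * circ_int (\<lambda>x y. u x y + v x y) r)"
    using assms by (intro sqrt_class_cong) (auto simp: circ_class_def circ_int_add distrib_left)
  finally show ?thesis
    using assms by (auto simp: circ_class_def circ_cont_arith)
qed

lemma circ_class_cmult:
  assumes "circ_class C L \<rho> N M u"
  shows "circ_class C L \<rho> N M (\<lambda>x y. k * u x y)"
  using assms sqrt_class_cmult[of C \<rho> N M "\<lambda>r. (\<Prod>l\<in>L. l - r\<^sup>2) * circ_int u r" k]
  by (auto simp: circ_class_def circ_int_cmult mult.left_commute circ_cont_arith circ_cont_basic)

lemma circ_class_sum:
  "(\<And>i. i \<in> I \<Longrightarrow> circ_class C L \<rho> N M (u i)) \<Longrightarrow> circ_class C L \<rho> N M (\<lambda>x y. \<Sum>i\<in>I. u i x y)"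
proof (induction I rule: infinite_finite_induct)
  case (insert i I)
  then show ?case by (simp add: circ_class_add)
qed (use sqrt_class_poly[of 0 N C \<rho> M] in
    \<open>auto simp: circ_class_def circ_cont_basic circ_int_def\<close>)

lemma circ_class_swap:
  assumes "circ_class C L \<rho> N M u"
  shows "circ_class C L \<rho> N M (\<lambda>x y. u y x)"
proof -
  have "sqrt_class C \<rho> N M (\<lambda>r. (\<Prod>l\<in>L. l - r\<^sup>2) * circ_int (\<lambda>x y. u y x) r) \<longleftrightarrow>
      sqrt_class C \<rho> N M (\<lambda>r. (\<Prod>l\<in>L. l - r\<^sup>2) * circ_int u r)"
    using assms by (intro sqrt_class_cong) (auto simp: circ_class_def circ_int_swap)
  then show ?thesis
    using assms by (auto simp: circ_class_def circ_cont_swap)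
qed

lemma circ_class_prod_diff_mult:
  assumes "circ_class C {} \<rho> N M u"
  shows "circ_class C L \<rho> (N + card L) (M + card L) u"
  using assms sqrt_class_prod_diff_mult[of C \<rho> N M "circ_int u" L] by (simp add: circ_class_def)

lemma circ_class_x_mult_over_linear:
  assumes "\<rho> \<le> \<bar>a\<bar>" "circ_class C L \<rho> N M u" "circ_class C L \<rho> N M (\<lambda>x y. u x y / (x - a))"
  shows "circ_class C L \<rho> N M (\<lambda>x y. x * u x y / (x - a))"
proof -
  have "x * u x y / (x - a) = u x y + a * (u x y / (x - a))" if "\<bar>x\<bar> < \<rho>" for x y
  proof -
    have "x - a \<noteq> 0" using assms(1) that by auto
    then show ?thesis by (simp add: field_simps)
  qed
  then have "circ_class C L \<rho> N M (\<lambda>x y. x * u x y / (x - a)) \<longleftrightarrow>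
      circ_class C L \<rho> N M (\<lambda>x y. u x y + a * (u x y / (x - a)))"
    by (intro circ_class_cong)
  with assms(2,3) show ?thesis by (simp only: circ_class_add circ_class_cmult)
qed

lemma circ_class_y_mult_over_linear:
  assumes "\<rho> \<le> \<bar>b\<bar>" "circ_class C L \<rho> N M u" "circ_class C L \<rho> N M (\<lambda>x y. u x y / (y - b))"
  shows "circ_class C L \<rho> N M (\<lambda>x y. y * u x y / (y - b))"
  by (rule circ_class_swap[OF circ_class_x_mult_over_linear[OF assms(1) assms(2,3)[THEN circ_class_swap]]])

lemma circ_class_y_squared_mult_over_linear:
  assumes a: "\<rho> \<le> \<bar>a\<bar>" and u: "\<And>r. 0 < r \<Longrightarrow> r < \<rho> \<Longrightarrow> circ_cont u r"
    and "circ_class C {} \<rho> N M (\<lambda>x y. u x y / (x - a))"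
    and "circ_class C {} \<rho> (Suc N) (Suc M) (\<lambda>x y. (x + a) * u x y)"
  shows "circ_class C {} \<rho> (Suc N) (Suc M) (\<lambda>x y. y\<^sup>2 * u x y / (x - a))"
proof -
  let ?h = "circ_int (\<lambda>x y. u x y / (x - a))" and ?k = "circ_int (\<lambda>x y. (x + a) * u x y)"
  have "sqrt_class C \<rho> (N + 1) (M + 1) (\<lambda>r. poly [:- a\<^sup>2, 1:] (r\<^sup>2) * ?h r)"
    using assms(3) by (intro sqrt_class_poly_mult) (simp_all add: circ_class_def)
  then have "sqrt_class C \<rho> (Suc N) (Suc M) (\<lambda>r. poly [:- a\<^sup>2, 1:] (r\<^sup>2) * ?h r + (-1) * ?k r)"
    using assms(4) by (intro sqrt_class_add sqrt_class_cmult) (simp_all add: circ_class_def)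
  also have "?this \<longleftrightarrow> sqrt_class C \<rho> (Suc N) (Suc M) (circ_int (\<lambda>x y. y\<^sup>2 * u x y / (x - a)))"
    using a u by (intro sqrt_class_cong) (simp add: circ_int_y_squared_over_linear)
  finally show ?thesis
    using a u by (simp add: circ_class_def circ_cont_intros)
qed

lemma circ_class_monomial: "circ_class C {} \<rho> ((i + j) div 2 + 1) M (\<lambda>x y. x ^ i * y ^ j)"
proof -
  let ?\<mu> = "circ_int (\<lambda>x y. x ^ i * y ^ j)"
  have cont: "circ_cont (\<lambda>x y. x ^ i * y ^ j) r" for r by (intro circ_cont_intros)
  have "\<exists>k. ?\<mu> = (\<lambda>r. poly (monom k ((i + j) div 2)) (r\<^sup>2))"
  proof (cases "even i \<and> even j")
    case False
    then consider "odd i" | "odd j" by blast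
    then have "?\<mu> r = 0" for r
      by cases (use circ_int_odd[OF cont, of r] in simp_all)
    then show ?thesis by (intro exI[of _ 0] ext) simp
  next
    case True
    then have "even (i + j)" by simp
    then have "r ^ (i + j) = (r\<^sup>2) ^ ((i + j) div 2)" for r :: real
      by (simp flip: power_mult)
    moreover define k where "k = ?\<mu> 1"
    have "?\<mu> r = r ^ (i + j) * k" for r
      unfolding k_def circ_int_def
      by (simp add: power_mult_distrib power_add mult_ac flip: integral_mult_right)
    ultimately show ?thesis by (intro exI[of _ k] ext) (simp add: poly_monom)
  qed
  then obtain k where k: "?\<mu> = (\<lambda>r. poly (monom k ((i + j) div 2)) (r\<^sup>2))" by blast
  have "length (coeffs (monom k ((i + j) div 2))) \<le> (i + j) div 2 + 1"
    by (cases "k = 0") (simp_all add: length_coeffs degree_monom_eq)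
  then have "sqrt_class C \<rho> ((i + j) div 2 + 1) M ?\<mu>"
    unfolding k by (rule sqrt_class_poly)
  with cont show ?thesis by (simp add: circ_class_def)
qed

lemma circ_class_recip_linear:
  assumes "finite C" "a\<^sup>2 \<in> C" "\<rho> \<le> \<bar>a\<bar>"
  shows "circ_class C {} \<rho> 0 1 (\<lambda>x y. 1 / (x - a))"
proof -
  have "sqrt_class C \<rho> 0 1 (\<lambda>r. - (2 * pi * sgn a) / sqrt (a\<^sup>2 - r\<^sup>2))"
    by (rule sqrt_class_recip_sqrt[OF assms(1,2)])
  also have "?this \<longleftrightarrow> sqrt_class C \<rho> 0 1 (circ_int (\<lambda>x y. 1 / (x - a)))"
    using assms(3) by (intro sqrt_class_cong circ_int_recip[symmetric]) auto
  finally show ?thesis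
    using assms(3) by (auto simp: circ_class_def intro!: circ_cont_intros)
qed

lemma circ_class_power_over_linear:
  assumes C: "finite C" "a\<^sup>2 \<in> C" and \<rho>: "\<rho> \<le> \<bar>a\<bar>"
  shows "circ_class C {} \<rho> ((j + 1) div 2) (j div 2 + 1) (\<lambda>x y. y ^ j / (x - a))"
proof (induction j rule: induct_nat_012)
  case 0
  then show ?case using circ_class_recip_linear[OF assms] by simp
next
  case 1
  have cont: "circ_cont (\<lambda>x y. y / (x - a)) r" if "0 < r" "r < \<rho>" for r
    using that \<rho> by (intro circ_cont_intros) auto
  have "sqrt_class C \<rho> 1 1 (\<lambda>r. poly 0 (r\<^sup>2))"
    by (rule sqrt_class_poly) simp
  also have "?this \<longleftrightarrow> sqrt_class C \<rho> 1 1 (circ_int (\<lambda>x y. y / (x - a)))"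
    using circ_int_odd(2)[OF cont] by (intro sqrt_class_cong) simp
  finally show ?case using cont by (simp add: circ_class_def)
next
  case (ge2 j)
  have "circ_class C {} \<rho> (Suc ((j + 1) div 2)) (Suc (j div 2 + 1))
      (\<lambda>x y. x ^ 1 * y ^ j + a * (x ^ 0 * y ^ j))"
    by (intro circ_class_add circ_class_cmult circ_class_mono[OF circ_class_monomial[where M = 0]]) auto
  then have "circ_class C {} \<rho> (Suc ((j + 1) div 2)) (Suc (j div 2 + 1)) (\<lambda>x y. (x + a) * y ^ j)"
    by (simp add: distrib_right)
  then have "circ_class C {} \<rho> (Suc ((j + 1) div 2)) (Suc (j div 2 + 1)) (\<lambda>x y. y\<^sup>2 * y ^ j / (x - a))"
    by (intro circ_class_y_squared_mult_over_linear[OF \<rho> _ ge2.IH(1)] circ_cont_intros)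
  then show ?case by (simp add: power2_eq_square mult.assoc)
qed

lemma circ_class_monomial_over_linear:
  assumes C: "finite C" "a\<^sup>2 \<in> C" and \<rho>: "\<rho> \<le> \<bar>a\<bar>"
  shows "circ_class C {} \<rho> ((i + j + 1) div 2) (j div 2 + 1) (\<lambda>x y. x ^ i * y ^ j / (x - a))"
proof (induction i)
  case 0
  then show ?case using circ_class_power_over_linear[OF assms] by simp
next
  case (Suc i)
  have "circ_class C {} \<rho> ((Suc i + j + 1) div 2) (j div 2 + 1) (\<lambda>x y. x * (x ^ i * y ^ j) / (x - a))"
    by (intro circ_class_x_mult_over_linear[OF \<rho>] circ_class_mono[OF Suc]
        circ_class_mono[OF circ_class_monomial[where M = 0]]) auto
  then show ?case by (simp add: mult.assoc)
qed

lemma circ_class_recip_bilinear: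
  assumes C: "finite C" "a\<^sup>2 \<in> C" "b\<^sup>2 \<in> C" and \<rho>: "\<rho> \<le> \<bar>a\<bar>" "\<rho> \<le> \<bar>b\<bar>"
    and L: "finite L" "a\<^sup>2 + b\<^sup>2 \<in> L"
  shows "circ_class C L \<rho> (card L) (card L) (\<lambda>x y. 1 / (x - a) / (y - b))"
proof -
  let ?L = "L - {a\<^sup>2 + b\<^sup>2}"
  let ?g = "\<lambda>r. (- a) * circ_int (\<lambda>x y. 1 / (x - b)) r + (- b) * circ_int (\<lambda>x y. 1 / (x - a)) r"
  have "sqrt_class C \<rho> 0 1 ?g"
    using circ_class_recip_linear[OF C(1,2) \<rho>(1)] circ_class_recip_linear[OF C(1,3) \<rho>(2)]
    by (intro sqrt_class_add sqrt_class_cmult) (simp_all add: circ_class_def)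
  then have "sqrt_class C \<rho> (0 + card ?L) (1 + card ?L) (\<lambda>r. (\<Prod>l\<in>?L. l - r\<^sup>2) * ?g r)"
    by (rule sqrt_class_prod_diff_mult)
  moreover have "Suc (card ?L) = card L"
    using L by (rule card.remove[symmetric])
  ultimately have "sqrt_class C \<rho> (card L) (card L) (\<lambda>r. (\<Prod>l\<in>?L. l - r\<^sup>2) * ?g r)"
    by (elim sqrt_class_mono) auto
  also have "?this \<longleftrightarrow> sqrt_class C \<rho> (card L) (card L)
      (\<lambda>r. (\<Prod>l\<in>L. l - r\<^sup>2) * circ_int (\<lambda>x y. 1 / (x - a) / (y - b)) r)"
  proof (rule sqrt_class_cong)
    fix r assume "0 < r" "r < \<rho>"
    then have "?g r = (a\<^sup>2 + b\<^sup>2 - r\<^sup>2) * circ_int (\<lambda>x y. 1 / (x - a) / (y - b)) r"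
      using circ_int_recip_mixed[of r a b] \<rho> by simp
    then show "(\<Prod>l\<in>?L. l - r\<^sup>2) * ?g r = (\<Prod>l\<in>L. l - r\<^sup>2) * circ_int (\<lambda>x y. 1 / (x - a) / (y - b)) r"
      unfolding prod.remove[OF L] by (simp only: mult_ac)
  qed
  moreover have "\<forall>r\<in>{0<..<\<rho>}. circ_cont (\<lambda>x y. 1 / (x - a) / (y - b)) r"
    using \<rho> by (intro ballI circ_cont_intros) auto
  ultimately show ?thesis
    unfolding circ_class_def by blast
qed

lemma circ_class_monomial_over_bilinear:
  assumes C: "finite C" "a\<^sup>2 \<in> C" "b\<^sup>2 \<in> C" and \<rho>: "\<rho> \<le> \<bar>a\<bar>" "\<rho> \<le> \<bar>b\<bar>"
    and L: "finite L" "a\<^sup>2 + b\<^sup>2 \<in> L" and ij: "i + j \<le> n + 1"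
  shows "circ_class C L \<rho> ((n + 1) div 2 + card L) ((n + 2) div 2 + card L)
    (\<lambda>x y. x ^ i * y ^ j / (x - a) / (y - b))"
proof -
  let ?P = "circ_class C L \<rho> ((n + 1) div 2 + card L) ((n + 2) div 2 + card L)"
  let ?H = "\<lambda>i j x y. x ^ i * y ^ j / (x - a) / (y - b)"
  have pole: "?P (\<lambda>x y. x ^ i * y ^ j / (x - c))" if "c\<^sup>2 \<in> C" "\<rho> \<le> \<bar>c\<bar>" "i + j \<le> n" for c i j
    by (intro circ_class_prod_diff_mult circ_class_mono[OF circ_class_monomial_over_linear[OF C(1) that(1,2)]])
      (use that(3) in \<open>auto intro!: div_le_mono\<close>)
  have y_pole: "?P (\<lambda>x y. x ^ i * y ^ j / (y - b))" if "i + j \<le> n" for i j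
    using circ_class_swap[OF pole[OF C(3) \<rho>(2), of j i]] that by (simp add: mult.commute)
  have corner: "?P (?H 0 0)"
    using circ_class_mono[OF circ_class_recip_bilinear[OF C \<rho> L]] by simp
  have "?P (?H 0 j)" if "j \<le> n + 1" for j
    using that
  proof (induction j)
    case (Suc j)
    then have "?P (\<lambda>x y. y * (x ^ 0 * y ^ j / (x - a)) / (y - b))"
      by (intro circ_class_y_mult_over_linear[OF \<rho>(2)] pole[OF C(2) \<rho>(1)]) auto
    then show ?case by (simp add: mult_ac)
  qed (rule corner)
  then have "?P (?H 0 j)" using ij by simp
  then show ?thesis
    using ij
  proof (induction i)
    case (Suc i)
    then have "?P (\<lambda>x y. x * (x ^ i * y ^ j / (y - b)) / (x - a))"
      by (intro circ_class_x_mult_over_linear[OF \<rho>(1)] y_pole)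
        (auto simp: divide_divide_eq_left mult.commute)
    then show ?case by (simp add: divide_divide_eq_left mult_ac)
  qed
qed

lemma circ_class_poly2:
  assumes "\<And>i j. i + j \<le> n + 1 \<Longrightarrow> circ_class C L \<rho> N M (\<lambda>x y. x ^ i * y ^ j * g x y)"
  shows "circ_class C L \<rho> N M (\<lambda>x y. (- y * poly2 q n x y - x * poly2 p n x y) * g x y)"
proof -
  let ?D = "{(i, j). i + j \<le> n}"
  have "circ_class C L \<rho> N M (\<lambda>x y. \<Sum>z\<in>?D. - q (fst z) (snd z) * (x ^ fst z * y ^ Suc (snd z) * g x y)
      + - p (fst z) (snd z) * (x ^ Suc (fst z) * y ^ snd z * g x y))"
    by (intro circ_class_sum circ_class_add circ_class_cmult assms) auto
  also have "(\<lambda>x y. \<Sum>z\<in>?D. - q (fst z) (snd z) * (x ^ fst z * y ^ Suc (snd z) * g x y)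
      + - p (fst z) (snd z) * (x ^ Suc (fst z) * y ^ snd z * g x y))
    = (\<lambda>x y. (- y * poly2 q n x y - x * poly2 p n x y) * g x y)"
    unfolding poly2_def sum_distrib_left sum_distrib_right sum_subtractf[symmetric]
    by (intro ext sum.cong) (auto simp: algebra_simps)
  finally show ?thesis .
qed

lemma circ_class_abelian_integrand:
  assumes recip: "\<And>x y. \<bar>x\<bar> < \<rho> \<Longrightarrow> \<bar>y\<bar> < \<rho> \<Longrightarrow> 1 / G x y = (\<Sum>k\<in>K. w k * g k x y)"
    and "\<And>i j k. i + j \<le> n + 1 \<Longrightarrow> k \<in> K \<Longrightarrow> circ_class C L \<rho> N M (\<lambda>x y. x ^ i * y ^ j * g k x y)"
  shows "circ_class C L \<rho> N M (\<lambda>x y. (- y * poly2 q n x y - x * poly2 p n x y) * (1 / G x y))"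
proof (rule circ_class_poly2)
  fix i j assume "i + j \<le> n + 1"
  then have "circ_class C L \<rho> N M (\<lambda>x y. \<Sum>k\<in>K. w k * (x ^ i * y ^ j * g k x y))"
    by (intro circ_class_sum circ_class_cmult assms(2))
  also have "?this \<longleftrightarrow> circ_class C L \<rho> N M (\<lambda>x y. x ^ i * y ^ j * (1 / G x y))"
    by (intro circ_class_cong) (simp add: recip sum_distrib_left mult_ac del: divide_eq_1_iff)
  finally show "circ_class C L \<rho> N M (\<lambda>x y. x ^ i * y ^ j * (1 / G x y))" .
qed

subsection \<open>The Abelian integral\<close>

lemma abelian_int_eq_circ_int:
  "abelian_int P Q G = circ_int (\<lambda>x y. (- y * Q x y - x * P x y) * (1 / G x y))"
  unfolding abelian_int_def circ_int_def by (simp add: fun_eq_iff mult_ac)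

lemma partial_fractions:
  fixes A :: "'a::field set"
  assumes "finite A" "A \<noteq> {}"
  shows "\<exists>w. \<forall>x. x \<notin> A \<longrightarrow> 1 / (\<Prod>\<alpha>\<in>A. x - \<alpha>) = (\<Sum>\<alpha>\<in>A. w \<alpha> / (x - \<alpha>))"
  using assms
proof (induction A rule: finite_ne_induct)
  case (singleton \<alpha>)
  show ?case by (rule exI[of _ "\<lambda>_. 1"]) simp
next
  case (insert \<kappa> A)
  then obtain w where w: "\<And>x. x \<notin> A \<Longrightarrow> 1 / (\<Prod>\<alpha>\<in>A. x - \<alpha>) = (\<Sum>\<alpha>\<in>A. w \<alpha> / (x - \<alpha>))"
    by auto
  let ?v = "\<lambda>\<alpha>. w \<alpha> / (\<alpha> - \<kappa>)"
  let ?v' = "?v(\<kappa> := - (\<Sum>\<alpha>\<in>A. ?v \<alpha>))"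
  have "1 / (\<Prod>\<alpha>\<in>insert \<kappa> A. x - \<alpha>) = (\<Sum>\<alpha>\<in>insert \<kappa> A. ?v' \<alpha> / (x - \<alpha>))"
    if x: "x \<notin> insert \<kappa> A" for x
  proof -
    have "1 / (\<Prod>\<alpha>\<in>insert \<kappa> A. x - \<alpha>) = 1 / (\<Prod>\<alpha>\<in>A. x - \<alpha>) / (x - \<kappa>)"
      using insert.hyps by (simp add: mult.commute)
    also have "\<dots> = (\<Sum>\<alpha>\<in>A. w \<alpha> / (x - \<alpha>) / (x - \<kappa>))"
      using x by (simp add: w sum_divide_distrib)
    also have "\<dots> = (\<Sum>\<alpha>\<in>A. ?v \<alpha> / (x - \<alpha>) - ?v \<alpha> / (x - \<kappa>))"
    proof (rule sum.cong[OF refl])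
      fix \<alpha> assume "\<alpha> \<in> A"
      then have "\<alpha> - \<kappa> \<noteq> 0" "x - \<alpha> \<noteq> 0" "x - \<kappa> \<noteq> 0" using insert.hyps x by auto
      then show "w \<alpha> / (x - \<alpha>) / (x - \<kappa>) = ?v \<alpha> / (x - \<alpha>) - ?v \<alpha> / (x - \<kappa>)"
        by (simp add: divide_simps) (simp add: algebra_simps)
    qed
    also have "\<dots> = (\<Sum>\<alpha>\<in>A. ?v \<alpha> / (x - \<alpha>)) + - (\<Sum>\<alpha>\<in>A. ?v \<alpha>) / (x - \<kappa>)"
      by (simp add: sum_subtractf sum_divide_distrib)
    also have "(\<Sum>\<alpha>\<in>A. ?v \<alpha> / (x - \<alpha>)) = (\<Sum>\<alpha>\<in>A. ?v' \<alpha> / (x - \<alpha>))"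
      using insert.hyps by (intro sum.cong) auto
    finally show ?thesis using insert.hyps by simp
  qed
  then show ?case by blast
qed

lemma partial_fractions_prod:
  fixes A B :: "'a::field set"
  assumes "finite A" "A \<noteq> {}" "finite B" "B \<noteq> {}"
  shows "\<exists>w. \<forall>x y. x \<notin> A \<longrightarrow> y \<notin> B \<longrightarrow> 1 / ((\<Prod>\<alpha>\<in>A. x - \<alpha>) * (\<Prod>\<beta>\<in>B. y - \<beta>)) =
    (\<Sum>k\<in>A \<times> B. w k / (x - fst k) / (y - snd k))"
proof -
  obtain u where u: "\<And>x. x \<notin> A \<Longrightarrow> 1 / (\<Prod>\<alpha>\<in>A. x - \<alpha>) = (\<Sum>\<alpha>\<in>A. u \<alpha> / (x - \<alpha>))"
    using partial_fractions[OF assms(1,2)] by blast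
  obtain v where v: "\<And>y. y \<notin> B \<Longrightarrow> 1 / (\<Prod>\<beta>\<in>B. y - \<beta>) = (\<Sum>\<beta>\<in>B. v \<beta> / (y - \<beta>))"
    using partial_fractions[OF assms(3,4)] by blast
  have "1 / ((\<Prod>\<alpha>\<in>A. x - \<alpha>) * (\<Prod>\<beta>\<in>B. y - \<beta>)) =
      (\<Sum>k\<in>A \<times> B. u (fst k) * v (snd k) / (x - fst k) / (y - snd k))" if "x \<notin> A" "y \<notin> B" for x y
  proof -
    have "1 / ((\<Prod>\<alpha>\<in>A. x - \<alpha>) * (\<Prod>\<beta>\<in>B. y - \<beta>)) =
        (\<Sum>\<alpha>\<in>A. u \<alpha> / (x - \<alpha>)) * (\<Sum>\<beta>\<in>B. v \<beta> / (y - \<beta>))"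
      using that by (simp flip: u v)
    then show ?thesis by (simp add: sum_product sum.cartesian_product')
  qed
  then show ?thesis by (intro exI[of _ "\<lambda>k. u (fst k) * v (snd k)"]) blast
qed

lemma abelian_int_x_poles_zeros_le:
  fixes p q :: "nat \<Rightarrow> nat \<Rightarrow> real" and n :: nat
  assumes A: "finite A" "A \<noteq> {}" "\<And>\<alpha>. \<alpha> \<in> A \<Longrightarrow> \<rho> \<le> \<bar>\<alpha>\<bar>"
  defines "I \<equiv> abelian_int (poly2 p n) (poly2 q n) (\<lambda>x y. \<Prod>\<alpha>\<in>A. x - \<alpha>)"
  assumes r0: "0 < r0" "r0 < \<rho>" "I r0 \<noteq> 0"
  shows "zeros_le {0<..<\<rho>} I (card (power2 ` A) * ((n + 3) div 2) + n div 2)"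
proof -
  let ?P = "circ_class (power2 ` A) {} \<rho> ((n + 2) div 2) ((n + 3) div 2)"
  obtain w where w: "\<And>x. x \<notin> A \<Longrightarrow> 1 / (\<Prod>\<alpha>\<in>A. x - \<alpha>) = (\<Sum>\<alpha>\<in>A. w \<alpha> / (x - \<alpha>))"
    using partial_fractions[OF A(1,2)] by blast
  have "?P (\<lambda>x y. (- y * poly2 q n x y - x * poly2 p n x y) * (1 / (\<Prod>\<alpha>\<in>A. x - \<alpha>)))"
  proof (rule circ_class_abelian_integrand)
    show "1 / (\<Prod>\<alpha>\<in>A. x - \<alpha>) = (\<Sum>\<alpha>\<in>A. w \<alpha> * (1 / (x - \<alpha>)))" if "\<bar>x\<bar> < \<rho>" for x
      using w[of x] A(3)[of x] that by auto
    show "?P (\<lambda>x y. x ^ i * y ^ j * (1 / (x - \<alpha>)))" if "i + j \<le> n + 1" "\<alpha> \<in> A" for i j \<alpha>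
      using circ_class_mono[OF circ_class_monomial_over_linear[of "power2 ` A" \<alpha> \<rho> i j]] A that by simp
  qed
  then have "zeros_le {0<..<\<rho>} I (card (power2 ` A) * ((n + 3) div 2) + (n + 2) div 2 - 1)"
    using A r0 by (intro sqrt_class_zeros_le[of _ _ "{}" _ _ _ r0])
      (auto simp: circ_class_def I_def abelian_int_eq_circ_int simp flip: abs_le_square_iff)
  then show ?thesis by simp
qed

lemma abelian_int_xy_poles_zeros_le:
  fixes p q :: "nat \<Rightarrow> nat \<Rightarrow> real" and n :: nat
  assumes A: "finite A" "A \<noteq> {}" "\<And>\<alpha>. \<alpha> \<in> A \<Longrightarrow> \<rho> \<le> \<bar>\<alpha>\<bar>"
    and B: "finite B" "B \<noteq> {}" "\<And>\<beta>. \<beta> \<in> B \<Longrightarrow> \<rho> \<le> \<bar>\<beta>\<bar>"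
  defines "L \<equiv> (\<lambda>(\<alpha>, \<beta>). \<alpha>\<^sup>2 + \<beta>\<^sup>2) ` (A \<times> B)"
    and "I \<equiv> abelian_int (poly2 p n) (poly2 q n) (\<lambda>x y. (\<Prod>\<alpha>\<in>A. x - \<alpha>) * (\<Prod>\<beta>\<in>B. y - \<beta>))"
  assumes r0: "0 < r0" "r0 < \<rho>" "I r0 \<noteq> 0"
  shows "zeros_le {0<..<\<rho>} I
    (card (power2 ` (A \<union> B)) * ((n + 2) div 2 + card L) + ((n + 1) div 2 + card L) - 1)"
proof -
  let ?C = "power2 ` (A \<union> B)" and ?G = "\<lambda>x y. (\<Prod>\<alpha>\<in>A. x - \<alpha>) * (\<Prod>\<beta>\<in>B. y - \<beta>)"
  let ?P = "circ_class ?C L \<rho> ((n + 1) div 2 + card L) ((n + 2) div 2 + card L)"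
  have fin: "finite ?C" "finite L" using A B by (auto simp: L_def)
  have square: "\<rho>\<^sup>2 \<le> x\<^sup>2" if "x \<in> A \<union> B" for x
    using A(3)[of x] B(3)[of x] that r0 by (auto simp flip: abs_le_square_iff)
  obtain w where w: "\<And>x y. x \<notin> A \<Longrightarrow> y \<notin> B \<Longrightarrow>
      1 / ?G x y = (\<Sum>k\<in>A \<times> B. w k / (x - fst k) / (y - snd k))"
    using partial_fractions_prod[OF A(1,2) B(1,2)] by blast
  have "?P (\<lambda>x y. (- y * poly2 q n x y - x * poly2 p n x y) * (1 / ?G x y))"
  proof (rule circ_class_abelian_integrand)
    show "1 / ?G x y = (\<Sum>k\<in>A \<times> B. w k * (1 / (x - fst k) / (y - snd k)))"
      if "\<bar>x\<bar> < \<rho>" "\<bar>y\<bar> < \<rho>" for x y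
      using w[of x y] A(3)[of x] B(3)[of y] that by auto
    fix i j k assume ij: "i + j \<le> n + 1" and k: "k \<in> A \<times> B"
    then have "(fst k)\<^sup>2 + (snd k)\<^sup>2 \<in> L" by (force simp: L_def)
    with fin A(3) B(3) ij k have "?P (\<lambda>x y. x ^ i * y ^ j / (x - fst k) / (y - snd k))"
      by (intro circ_class_monomial_over_bilinear) auto
    then show "?P (\<lambda>x y. x ^ i * y ^ j * (1 / (x - fst k) / (y - snd k)))" by simp
  qed
  then show ?thesis
    using r0 fin square by (intro sqrt_class_zeros_le[of _ _ L _ _ _ r0])
      (auto simp: circ_class_def I_def abelian_int_eq_circ_int L_def intro: add_increasing2)
qed

lemma card_power2_image: "card (power2 ` A) = card (abs ` A)" for A :: "real set"
proof -
  have "power2 ` A = power2 ` abs ` A" by (simp add: image_image)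
  moreover have "inj_on power2 (abs ` A)"
    by (rule inj_onI) (auto simp: power2_eq_iff)
  ultimately show ?thesis by (simp add: card_image)
qed

lemma abelian_int_zeros_le:
  fixes p q :: "nat \<Rightarrow> nat \<Rightarrow> real" and n :: nat
  assumes A: "finite A" "A \<noteq> {}" and B: "finite B"
    and \<rho>: "\<And>\<alpha>. \<alpha> \<in> A \<union> B \<Longrightarrow> \<rho> \<le> \<bar>\<alpha>\<bar>"
  defines "L \<equiv> (\<lambda>(\<alpha>, \<beta>). \<alpha>\<^sup>2 + \<beta>\<^sup>2) ` (A \<times> B)"
    and "I \<equiv> abelian_int (poly2 p n) (poly2 q n) (\<lambda>x y. (\<Prod>\<alpha>\<in>A. x - \<alpha>) * (\<Prod>\<beta>\<in>B. y - \<beta>))"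
  assumes r0: "0 < r0" "r0 < \<rho>" "I r0 \<noteq> 0"
  shows "\<exists>N. zeros_le {0<..<\<rho>} I N \<and> int N = (if B = {}
      then int (card (abs ` A)) * ((int n + 3) div 2) + int n div 2
      else int (card (abs ` (A \<union> B))) * ((int n + 2) div 2 + int (card L))
        + (int n - 1) div 2 + int (card L))"
proof (cases "B = {}")
  case True
  have "zeros_le {0<..<\<rho>} I (card (abs ` A) * ((n + 3) div 2) + n div 2)"
    using abelian_int_x_poles_zeros_le[OF A, of \<rho> r0 p n q] \<rho> r0 True
    by (simp add: I_def card_power2_image)
  moreover have "int ((n + 3) div 2) = (int n + 3) div 2" by linarith
  ultimately show ?thesis
    using True by (intro exI[of _ "card (abs ` A) * ((n + 3) div 2) + n div 2"]) (simp add: zdiv_int)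
next
  case False
  let ?c = "card (abs ` (A \<union> B)) * ((n + 2) div 2 + card L)"
  have "card L > 0" using A B False by (simp add: L_def card_gt_0_iff)
  then have "int (?c + ((n + 1) div 2 + card L) - 1) =
      int ?c + (int ((n + 1) div 2) - 1) + int (card L)"
    by linarith
  also have "int ((n + 1) div 2) - 1 = (int n - 1) div 2" by linarith
  also have "int ?c = int (card (abs ` (A \<union> B))) * ((int n + 2) div 2 + int (card L))"
    by (simp add: zdiv_int distrib_left)
  finally show ?thesis
    using abelian_int_xy_poles_zeros_le[OF A _ B False, of \<rho> r0 p n q] \<rho> r0 False
    by (intro exI[of _ "?c + ((n + 1) div 2 + card L) - 1"])
      (simp add: I_def L_def card_power2_image)
qed

lemma Gfun_eq_prod_poles:
  assumes "inj_on a {1..K1}" "inj_on b {1..K2}"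
  shows "Gfun K1 K2 a b = (\<lambda>x y. (\<Prod>\<alpha>\<in>a ` {1..K1}. x - \<alpha>) * (\<Prod>\<beta>\<in>b ` {1..K2}. y - \<beta>))"
  using assms by (simp add: Gfun_def fun_eq_iff prod.reindex)

theorem theorem1p1:
  fixes K1 K2 n :: nat and a b :: "nat \<Rightarrow> real" and p q :: "nat \<Rightarrow> nat \<Rightarrow> real"
  assumes "K1 \<ge> K2" and "K2 = 0 \<Longrightarrow> K1 \<ge> 1"
    and "inj_on a {1..K1}" and "\<forall>j\<in>{1..K1}. a j \<noteq> 0"
    and "inj_on b {1..K2}" and "\<forall>l\<in>{1..K2}. b l \<noteq> 0"
  defines "\<rho> \<equiv> Min ((\<lambda>j. \<bar>a j\<bar>) ` {1..K1} \<union> (\<lambda>l. \<bar>b l\<bar>) ` {1..K2})"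
    and "I \<equiv> abelian_int (poly2 p n) (poly2 q n) (Gfun K1 K2 a b)"
    and "Kt1 \<equiv> card ((\<lambda>j. \<bar>a j\<bar>) ` {1..K1})"
    and "Kt2 \<equiv> card ((\<lambda>j. \<bar>a j\<bar>) ` {1..K1} \<union> (\<lambda>l. \<bar>b l\<bar>) ` {1..K2}) - card ((\<lambda>j. \<bar>a j\<bar>) ` {1..K1})"
    and "L \<equiv> card {a j ^ 2 + b l ^ 2 | j l. j \<in> {1..K1} \<and> l \<in> {1..K2}}"
  assumes "\<exists>r\<in>{0<..<\<rho>}. I r \<noteq> 0"
  shows "finite {r \<in> {0<..<\<rho>}. I r = 0}
    \<and> (\<forall>r\<in>{0<..<\<rho>}. I r = 0 \<longrightarrow> (\<exists>k. (deriv ^^ k) I r \<noteq> 0))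
    \<and> int (\<Sum>r \<in> {r \<in> {0<..<\<rho>}. I r = 0}. zero_mult I r)
        \<le> (if K2 = 0
            then int Kt1 * ((int n + 3) div 2) + int n div 2
            else int (Kt1 + Kt2) * ((int n + 2) div 2 + int L) + (int n - 1) div 2 + int L)"
proof -
  let ?A = "a ` {1..K1}" and ?B = "b ` {1..K2}"
  have A: "?A \<noteq> {}" using assms(1,2) by (cases "K2 = 0") auto
  have \<rho>: "\<rho> \<le> \<bar>\<alpha>\<bar>" if "\<alpha> \<in> ?A \<union> ?B" for \<alpha>
    unfolding \<rho>_def using that by (intro Min_le) auto
  have card: "card (abs ` ?A) = Kt1" "card (abs ` (?A \<union> ?B)) = Kt1 + Kt2"
    by (simp_all add: Kt1_def Kt2_def image_Un image_image card_mono)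
  have L: "L = card ((\<lambda>(\<alpha>, \<beta>). \<alpha>\<^sup>2 + \<beta>\<^sup>2) ` (?A \<times> ?B))"
    unfolding L_def by (rule arg_cong[of _ _ card]) force
  have B: "?B = {} \<longleftrightarrow> K2 = 0" by auto
  note I = I_def[unfolded Gfun_eq_prod_poles[OF assms(3,5)]]
  obtain r0 where r0: "0 < r0" "r0 < \<rho>" "I r0 \<noteq> 0" using assms(12) by auto
  obtain N where N: "zeros_le {0<..<\<rho>} I N" and bound: "int N = (if K2 = 0
      then int Kt1 * ((int n + 3) div 2) + int n div 2
      else int (Kt1 + Kt2) * ((int n + 2) div 2 + int L) + (int n - 1) div 2 + int L)"
    using abelian_int_zeros_le[OF _ A _ \<rho> r0[unfolded I]]
    unfolding I[symmetric] card L[symmetric] B by blast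
  show ?thesis
    unfolding bound[symmetric] of_nat_le_iff
    using zeros_le_imp_finite_zeros[OF N] zeros_le_imp_finite_order[OF N]
      zeros_le_imp_sum_zero_mult_le[OF N] by blast
qed

end
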